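(* Let $(\Xi,\mathscr{M})$ be a measurable space and let $(H,\|\cdot\|)$ be a separable Hilbert space. Let $\{X_\xi\}_{\xi\in\Xi}\subseteq L^2_H$ be a family of square-integrable $H$-valued random variables such that the map $\xi\mapsto X_\xi$ is measurable from $\Xi$ to $L^2_H$. Fix any integer $n\ge1$ with $n\le\dim H$. Then there exist measurable maps $v_i:\Xi\to H$, $i=1,\dots,n$, such that the following hold. (a) For all $\xi\in\Xi$ and $i,j\in\{1,\dots,n\}$, $\langle v_i(\xi),v_j(\xi)\rangle=\delta_{i,j}$, and for all $\xi\in\Xi$ $$\mathbb{E}\left\|X_\xi-\sum_{i=1}^n\langle X_\xi,v_i(\xi)\rangle v_i(\xi)\right\|^2=\inf_{Z\in Q_n}\mathbb{E}\|X_\xi-Z\|^2,$$ where $Q_n=\{Z\in L^2_H:\ \exists\, V\subseteq H\text{ linear subspace},\ \dim(V)\le n,\ Z\in V\text{ almost surely}\}$. (b) Furthermore, if $\Xi$ is a metric space and $\mathbb{E}\|X_\xi-X_{\xi'}\|^2\to0$ whenever $\xi\to\xi'$, then the maps $\xi\mapsto\mathbb{E}|\langle X_\xi,v_i(\xi)\rangle|^2$, $i=1,\dots,n$, are continuous.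
   Context: All random variables are defined on one common complete, separable probability space $(\mathbb{S},\mathcal{A},\mathbb{P})$, with expectation $\mathbb{E}$. An $H$-valued random variable is a Borel measurable map $\mathbb{S}\to H$. $L^2_H$ is the (separable Banach) space of (classes of) $H$-valued random variables $X$ with $\|X\|_{L^2_H}:=(\mathbb{E}\|X\|^2)^{1/2}<\infty$, with the Borel $\sigma$-algebra of this norm. *)

theory Defs
  imports "HOL-Probability.Probability" "HOL-Library.Extended_Nat"
begin

(* The library's dim is 0 on infinite-dimensional sets; here it is infinity. *)
definition edim :: "'a::real_vector set \<Rightarrow> enat" where
  "edim V = (if \<exists>B. finite B \<and> V \<subseteq> span B then enat (dim V) else \<infinity>)"

(* Separability of the measure algebra under the distance P(A \<triangle> B);
   for a probability measure this is equivalent to separability of L^2. *)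
definition separable_measure :: "'s measure \<Rightarrow> bool" where
  "separable_measure M \<longleftrightarrow>
     (\<exists>C. countable C \<and> C \<subseteq> sets M \<and>
        (\<forall>A\<in>sets M. \<forall>e>0. \<exists>B\<in>C. measure M (sym_diff A B) < e))"

(* Square-integrable random variables, as representatives: functions, not classes modulo
   almost sure equality. *)
definition L2_fun :: "'s measure \<Rightarrow> ('s \<Rightarrow> 'h::{real_inner, second_countable_topology}) set" where
  "L2_fun M = {X \<in> borel_measurable M. integrable M (\<lambda>s. (norm (X s))\<^sup>2)}"

definition L2_norm :: "'s measure \<Rightarrow> ('s \<Rightarrow> 'h::{real_inner, second_countable_topology}) \<Rightarrow> real" where
  "L2_norm M X = sqrt (\<integral>s. (norm (X s))\<^sup>2 \<partial>M)"

definition L2_open ::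
    "'s measure \<Rightarrow> ('s \<Rightarrow> 'h::{real_inner, second_countable_topology}) set \<Rightarrow> bool" where
  "L2_open M U \<longleftrightarrow> U \<subseteq> L2_fun M \<and>
     (\<forall>X\<in>U. \<exists>e>0. \<forall>Y\<in>L2_fun M. L2_norm M (\<lambda>s. Y s - X s) < e \<longrightarrow> Y \<in> U)"

(* Borel sigma-algebra of the L^2 norm. An L2_open set contains with X every Y that equals X
   almost surely, so these sets are exactly the preimages of the open sets of the Banach space
   of classes. Hence a map into L2_fun is measurable for this sigma-algebra iff the induced map
   into the space of classes is Borel measurable. *)
definition L2_borel ::
    "'s measure \<Rightarrow> ('s \<Rightarrow> 'h::{real_inner, second_countable_topology}) measure" where
  "L2_borel M = sigma (L2_fun M) {U. L2_open M U}"

definition low_rank :: "'s measure \<Rightarrow> nat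
    \<Rightarrow> ('s \<Rightarrow> 'h::{real_inner, second_countable_topology}) set" where
  "low_rank M n =
     {Z \<in> L2_fun M. \<exists>V. subspace V \<and> edim V \<le> enat n \<and> (AE s in M. Z s \<in> V)}"

end

theory Submission
  imports Defs "HOL-Complex_Analysis.Great_Picard"
begin

text \<open>
  The maps \<open>v\<^sub>i\<close> are eigenvectors, in decreasing order of the eigenvalues, of the covariance operator
  \<open>C u = E \<langle>X,u\<rangle> X\<close>, which is positive and compact and depends continuously on \<open>X\<close> in the
  \<open>L\<^sup>2\<close> norm. A measurable choice is obtained without a selection theorem: on the orthogonal complement
  \<open>W\<close> of the vectors already found, the top eigenvalue \<open>L\<close> is a supremum of Rayleigh quotients over
  a countable dense set, and the powers of \<open>(C + 1) / (L + 1)\<close> converge strongly on \<open>W\<close> to the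
  projection onto the top eigenspace. This projection does not annihilate the whole dense set, so
  its first nonzero value, normalised, is the next eigenvector. Optimality is the Ky Fan inequality
  \<open>\<Sum>\<^sub>j \<langle>C w\<^sub>j, w\<^sub>j\<rangle> \<le> \<lambda>\<^sub>1 + \<dots> + \<lambda>\<^sub>n\<close> for orthonormal \<open>w\<^sub>1, \<dots>, w\<^sub>m\<close> with \<open>m \<le> n\<close>. The same
  inequality bounds the change of each partial sum of eigenvalues, whence the continuity of every
  single eigenvalue as a difference of two partial sums.
\<close>

section \<open>Compact positive operators\<close>

text \<open>The common source of the Cauchy-Schwarz inequalities below. With \<open>a = 0\<close> it
  forces \<open>b = 0\<close>, which is how the first-order condition at a minimiser is read
  off.\<close>

lemma nonneg_quadratic_discriminant:
  fixes a b c :: real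
  assumes "0 \<le> c" and "\<And>t. 0 \<le> a + 2 * t * b + t\<^sup>2 * c"
  shows "b\<^sup>2 \<le> a * c"
proof (cases "c = 0")
  case True
  have "b = 0"
  proof (rule ccontr)
    assume "b \<noteq> 0"
    \<comment> \<open>With \<open>c = 0\<close> the expression is affine in \<open>t\<close>, and
      this \<open>t\<close> gives it the value -1.\<close>
    then show False
      using assms(2)[of "- (a + 1) / (2 * b)"] True by (simp add: field_simps)
  qed
  then show ?thesis using True by simp
next
  case False
  then have "0 < c" using assms(1) by simp
  then show ?thesis
    using assms(2)[of "- b / c"] by (simp add: field_simps power2_eq_square)
qed

lemma riesz_representation:
  fixes f :: "'h::{real_inner, complete_space} \<Rightarrow> real"
  assumes "bounded_linear f"
  shows "\<exists>a. \<forall>x. f x = inner a x"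
proof -
  interpret f: bounded_linear f by fact
  obtain K where K: "\<And>x. \<bar>f x\<bar> \<le> norm x * K" using f.bounded by auto
  \<comment> \<open>If \<open>a\<close> represents \<open>f\<close>, then
    \<open>J x = (norm (x - a))^2 - (norm a)^2\<close>; the representing vector is therefore sought
    as the minimiser of \<open>J\<close>.\<close>
  define J where "J x = (norm x)\<^sup>2 - 2 * f x" for x
  have J_ge: "- K\<^sup>2 \<le> J x" for x
  proof -
    have "f x \<le> norm x * K" using K[of x] by linarith
    moreover have "0 \<le> (norm x - K)\<^sup>2" by simp
    ultimately show ?thesis unfolding J_def by (simp add: power2_diff algebra_simps)
  qed
  define m where "m = (INF x. J x)"
  have bdd: "bdd_below (range J)" using J_ge by (auto intro!: bdd_belowI)
  have m_le: "m \<le> J x" for x unfolding m_def by (rule cINF_lower[OF bdd]) simp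
  have "\<exists>x. J x < m + 1 / Suc k" for k
    using cINF_less_iff[OF _ bdd, of "m + 1 / Suc k"] by (auto simp: m_def)
  then obtain x where x: "\<And>k. J (x k) < m + 1 / Suc k" by metis
  \<comment> \<open>Parallelogram law: the linear terms cancel. As \<open>J\<close> of the midpoint
    is at least \<open>m\<close>, the right-hand side for \<open>x i\<close> and \<open>x j\<close>
    is below \<open>4 / Suc k\<close> once \<open>i\<close> and \<open>j\<close> are at least
    \<open>k\<close>, so the minimising sequence is Cauchy.\<close>
  have par: "(norm (a - b))\<^sup>2 = 2 * J a + 2 * J b - 4 * J ((1/2) *\<^sub>R (a + b))" for a b
    unfolding J_def
    by (simp add: f.scaleR f.add power2_norm_eq_inner inner_simps algebra_simps inner_commute)
  have "Cauchy x"
  proof (rule metric_CauchyI)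
    fix e :: real assume "0 < e"
    then obtain k where k: "4 / Suc k < e\<^sup>2"
      using reals_Archimedean[of "e\<^sup>2 / 4"] by (auto simp: field_simps)
    have "dist (x i) (x j) < e" if "k \<le> i" "k \<le> j" for i j
    proof -
      have "(1::real) / Suc i \<le> 1 / Suc k" "(1::real) / Suc j \<le> 1 / Suc k"
        using that by (auto simp: frac_le)
      then have "(norm (x i - x j))\<^sup>2 < e\<^sup>2"
        using par[of "x i" "x j"] x[of i] x[of j] m_le[of "(1/2) *\<^sub>R (x i + x j)"] k
        by simp
      then show ?thesis using \<open>0 < e\<close> by (simp add: dist_norm power_less_imp_less_base)
    qed
    then show "\<exists>M. \<forall>m\<ge>M. \<forall>n\<ge>M. dist (x m) (x n) < e" by blast
  qed
  then obtain a where a: "x \<longlonglongrightarrow> a" using Cauchy_convergent convergentD by blast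
  have "(\<lambda>k. J (x k)) \<longlonglongrightarrow> J a"
    unfolding J_def by (intro tendsto_intros a f.tendsto)
  moreover have "(\<lambda>k. m + 1 / Suc k) \<longlonglongrightarrow> m + 0"
    by (intro tendsto_intros LIMSEQ_Suc lim_1_over_n)
  ultimately have "J a \<le> m + 0"
    by (intro LIMSEQ_le) (use x in \<open>auto intro: less_imp_le\<close>)
  then have min: "J a \<le> J (a + t *\<^sub>R w)" for t w using m_le order_trans by fastforce
  have "f w = inner a w" for w
  proof -
    have "0 \<le> 0 + 2 * t * (inner a w - f w) + t\<^sup>2 * (norm w)\<^sup>2" for t
    proof -
      have "J (a + t *\<^sub>R w) = J a + (2 * t * (inner a w - f w) + t\<^sup>2 * (norm w)\<^sup>2)"
        unfolding J_def
        unfolding power2_norm_eq_inner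
        by (simp add: f.scaleR f.add inner_simps inner_commute[of w a] algebra_simps
          power2_eq_square)
      then show ?thesis using min[of t w] by simp
    qed
    from nonneg_quadratic_discriminant[OF _ this] show ?thesis by simp
  qed
  then show ?thesis by blast
qed

section \<open>Residuals of finite orthonormal families\<close>

lemma orthonormal_residual_norm:
  fixes w :: "'i \<Rightarrow> 'h::real_inner"
  assumes "finite J" and "\<And>i j. i \<in> J \<Longrightarrow> j \<in> J \<Longrightarrow> inner (w i) (w j) = (if i = j then 1 else 0)"
  shows "(norm (x - (\<Sum>j\<in>J. inner x (w j) *\<^sub>R w j)))\<^sup>2 = (norm x)\<^sup>2 - (\<Sum>j\<in>J. (inner x (w j))\<^sup>2)"
proof -
  define p where "p = (\<Sum>j\<in>J. inner x (w j) *\<^sub>R w j)"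
  have px: "inner p x = (\<Sum>j\<in>J. (inner x (w j))\<^sup>2)"
    unfolding p_def by (simp add: inner_sum_left power2_eq_square inner_commute[of x])
  have pw: "inner p (w i) = inner x (w i)" if "i \<in> J" for i
    unfolding p_def using that assms
    by (simp add: inner_sum_left if_distrib[of "\<lambda>z. _ * z"] sum.delta cong: if_cong)
  have "inner p p = (\<Sum>j\<in>J. inner x (w j) * inner p (w j))"
    by (subst (2) p_def) (simp add: inner_sum_right)
  then have "inner p p = inner p x" using pw px by (simp add: power2_eq_square)
  then show ?thesis
    unfolding p_def[symmetric] px[symmetric] power2_norm_eq_inner
    by (simp add: inner_simps inner_commute)
qed

lemma orthonormal_residual_orthogonal:
  fixes w :: "'i \<Rightarrow> 'h::real_inner"
  assumes "finite J" and "\<And>i j. i \<in> J \<Longrightarrow> j \<in> J \<Longrightarrow> inner (w i) (w j) = (if i = j then 1 else 0)"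
    and "i \<in> J"
  shows "inner (x - (\<Sum>j\<in>J. inner x (w j) *\<^sub>R w j)) (w i) = 0"
  using assms
  by (simp add: inner_diff_left inner_sum_left if_distrib[of "\<lambda>z. _ * z"] sum.delta cong: if_cong)

lemma bessel_inequality:
  fixes w :: "'i \<Rightarrow> 'h::real_inner"
  assumes "finite J" and "\<And>i j. i \<in> J \<Longrightarrow> j \<in> J \<Longrightarrow> inner (w i) (w j) = (if i = j then 1 else 0)"
  shows "(\<Sum>j\<in>J. (inner x (w j))\<^sup>2) \<le> (norm x)\<^sup>2"
  using orthonormal_residual_norm[OF assms, of x]
    zero_le_power2[of "norm (x - (\<Sum>j\<in>J. inner x (w j) *\<^sub>R w j))"] by linarith

text \<open>Cauchy-Schwarz for the positive form \<open>inner (T u) w\<close> on \<open>W\<close>,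
  taken at \<open>w = T u\<close>: it gives
  \<open>(norm w)^4 \<le> inner (T u) u * inner (T w) w\<close>, the last factor is at most
  \<open>L * (norm w)^2\<close>, and one factor \<open>(norm w)^2\<close> cancels.\<close>

lemma norm_le_rayleigh:
  fixes T :: "'h::real_inner \<Rightarrow> 'h"
  assumes "linear T" and sub: "subspace W" and inv: "\<And>u. u \<in> W \<Longrightarrow> T u \<in> W"
    and sym: "\<And>u w. inner (T u) w = inner u (T w)"
    and pos: "\<And>u. u \<in> W \<Longrightarrow> 0 \<le> inner (T u) u"
    and le: "\<And>u. u \<in> W \<Longrightarrow> inner (T u) u \<le> L * (norm u)\<^sup>2"
    and u: "u \<in> W"
  shows "(norm (T u))\<^sup>2 \<le> L * inner (T u) u"
proof (cases "T u = 0")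
  case False
  interpret T: linear T by fact
  define w where "w = T u"
  have w: "w \<in> W" unfolding w_def by (rule inv[OF u])
  have "0 \<le> inner (T u) u + 2 * t * inner (T u) w + t\<^sup>2 * inner (T w) w" for t
  proof -
    have "u + t *\<^sub>R w \<in> W" using u w sub by (simp add: subspace_add subspace_scale)
    moreover have "inner (T w) u = inner (T u) w"
      using sym[of w u] inner_commute[of w "T u"] by simp
    then have "inner (T (u + t *\<^sub>R w)) (u + t *\<^sub>R w)
        = inner (T u) u + 2 * t * inner (T u) w + t\<^sup>2 * inner (T w) w"
      by (simp add: T.add T.scaleR inner_simps power2_eq_square algebra_simps)
    ultimately show ?thesis using pos[of "u + t *\<^sub>R w"] by simp
  qed
  from nonneg_quadratic_discriminant[OF pos[OF w] this]
  have "(inner (T u) w)\<^sup>2 \<le> inner (T u) u * inner (T w) w" .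
  also have "\<dots> \<le> inner (T u) u * (L * (norm w)\<^sup>2)"
    by (rule mult_left_mono[OF le[OF w] pos[OF u]])
  finally have "(norm (T u))\<^sup>2 * (norm (T u))\<^sup>2 \<le> (L * inner (T u) u) * (norm (T u))\<^sup>2"
    by (simp add: w_def power2_norm_eq_inner[symmetric] power2_eq_square[of "norm _ ^ 2"] mult_ac
      power_mult_distrib)
  then show ?thesis using False by (simp only: mult_le_cancel_right) simp
qed (simp)

text \<open>The moments \<open>a m = inner ((T ^^ m) u) u\<close> are nonnegative and decreasing,
  and by symmetry they determine all distances between the iterates, which are therefore Cauchy. The
  last clause makes \<open>p\<close> the orthogonal projection of \<open>u\<close> onto the fixed
  space; it later shows that some limit is not zero.\<close>

lemma contraction_powers_tendsto_fixpoint: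
  fixes T :: "'h::{real_inner, complete_space} \<Rightarrow> 'h"
  assumes bl: "bounded_linear T" and sub: "subspace W" and cl: "closed W"
    and inv: "\<And>u. u \<in> W \<Longrightarrow> T u \<in> W"
    and sym: "\<And>u w. inner (T u) w = inner u (T w)"
    and pos: "\<And>u. u \<in> W \<Longrightarrow> 0 \<le> inner (T u) u"
    and le: "\<And>u. u \<in> W \<Longrightarrow> inner (T u) u \<le> (norm u)\<^sup>2"
    and u: "u \<in> W"
  shows "\<exists>p\<in>W. (\<lambda>k. (T ^^ k) u) \<longlonglongrightarrow> p \<and> T p = p \<and> (\<forall>w. T w = w \<longrightarrow> inner p w = inner u w)"
proof -
  have lin: "linear T" using bl by (rule bounded_linear.linear)
  have W: "(T ^^ k) u \<in> W" for k by (induction k) (auto simp: u inv)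
  have shift: "inner ((T ^^ k) x) y = inner x ((T ^^ k) y)" for k x y
    
  proof (induction k arbitrary: y)
    case (Suc k)
    have "inner ((T ^^ Suc k) x) y = inner ((T ^^ k) x) (T y)" by (simp add: sym)
    also have "\<dots> = inner x ((T ^^ Suc k) y)" unfolding Suc.IH funpow_Suc_right by simp
    finally show ?case .
  qed simp
  define a where "a m = inner ((T ^^ m) u) u" for m
  have a: "inner ((T ^^ k) u) ((T ^^ l) u) = a (k + l)" for k l
    unfolding a_def shift by (metis funpow_add inner_commute o_apply shift)
  have contr: "(norm (T x))\<^sup>2 \<le> inner (T x) x" if "x \<in> W" for x
    using norm_le_rayleigh[OF lin sub inv sym pos, of 1 x] le that by simp
  have a_nonneg: "0 \<le> a (2 * k)" for k by (simp add: mult_2 a[symmetric])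
  \<comment> \<open>With \<open>x = (T ^^ k) u\<close>, the even case is
    \<open>inner (T x) x \<le> inner x x\<close> and the odd case
    \<open>inner (T x) (T x) \<le> inner (T x) x\<close>.\<close>
  have step: "a (Suc m) \<le> a m" for m
  proof (cases "even m")
    case True
    then obtain k where "m = k + k" by (metis evenE mult_2)
    then show ?thesis
      using le[OF W[of k]] a[of k k] a[of "Suc k" k] by (simp add: power2_norm_eq_inner)
  next
    case False
    then obtain k where "m = Suc (k + k)" by (metis oddE mult_2 Suc_eq_plus1)
    then show ?thesis
      using contr[OF W[of k]] a[of "Suc k" k] a[of "Suc k" "Suc k"]
      by (simp add: power2_norm_eq_inner)
  qed
  then have dec: "decseq a" by (rule decseq_SucI)
  have "0 \<le> a m" for m
    using a_nonneg[of m] decseqD[OF dec, of m "2 * m"] by linarith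
  then have "convergent a" using decseq_convergent[OF dec] convergentI by metis
  then have "Cauchy a" by (rule convergent_Cauchy)
  have "Cauchy (\<lambda>k. (T ^^ k) u)"
  proof (rule metric_CauchyI)
    fix e :: real assume "0 < e"
    then obtain K where K: "\<And>k l. K \<le> k \<Longrightarrow> K \<le> l \<Longrightarrow> dist (a k) (a l) < e\<^sup>2"
      using metric_CauchyD[OF \<open>Cauchy a\<close>, of "e\<^sup>2"] by auto
    have main: "dist ((T ^^ k) u) ((T ^^ l) u) < e" if "K \<le> k" "k \<le> l" for k l
    proof -
      have "(norm ((T ^^ k) u - (T ^^ l) u))\<^sup>2 = a (2 * k) - 2 * a (k + l) + a (2 * l)"
        by (simp add: power2_norm_eq_inner inner_diff_left inner_diff_right a mult_2[where 'a = nat] add.commute)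
      also have "\<dots> \<le> a (2 * k) - a (2 * l)"
        using decseqD[OF dec, of "k + l" "2 * l"] that by simp
      also have "\<dots> < e\<^sup>2"
        using K[of "2 * k" "2 * l"] that by (simp add: dist_real_def abs_less_iff)
      finally show ?thesis using \<open>0 < e\<close> by (simp add: dist_norm power_less_imp_less_base)
    qed
    have "dist ((T ^^ k) u) ((T ^^ l) u) < e" if "K \<le> k" "K \<le> l" for k l
      using main[of k l] main[of l k] that by (cases "k \<le> l") (auto simp: dist_commute)
    then show "\<exists>M. \<forall>m\<ge>M. \<forall>n\<ge>M. dist ((T ^^ m) u) ((T ^^ n) u) < e" by blast
  qed
  then obtain p where p: "(\<lambda>k. (T ^^ k) u) \<longlonglongrightarrow> p" using Cauchy_convergent convergentD by blast
  have "(\<lambda>k. (T ^^ Suc k) u) \<longlonglongrightarrow> T p" using bounded_linear.tendsto[OF bl p] by simp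
  then have "T p = p" using LIMSEQ_Suc[OF p] LIMSEQ_unique by blast
  moreover have "inner p w = inner u w" if "T w = w" for w
  proof -
    have "(T ^^ k) w = w" for k by (induction k) (simp_all add: that)
    then have "inner ((T ^^ k) u) w = inner u w" for k by (simp add: shift)
    then have "(\<lambda>k. inner u w) \<longlonglongrightarrow> inner p w"
      using tendsto_inner[OF p tendsto_const, of w] by simp
    then show ?thesis using LIMSEQ_unique tendsto_const by metis
  qed
  moreover have "p \<in> W" by (rule closed_sequentially[OF cl W p])
  ultimately show ?thesis using p by blast
qed

section \<open>The top eigenvalue of a compact operator\<close>

locale compact_positive =
  fixes A :: "'h::{real_inner, complete_space} \<Rightarrow> 'h"
  assumes bounded_linear: "bounded_linear A"
    and symmetric: "inner (A u) w = inner u (A w)"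
    and nonneg: "0 \<le> inner (A u) u"
    and compact: "(\<And>k. norm (x k) \<le> 1) \<Longrightarrow>
      \<exists>r a. strict_mono (r :: nat \<Rightarrow> nat) \<and> (\<lambda>k. A (x (r k))) \<longlonglongrightarrow> a"
begin

lemma linear: "linear A"
  using bounded_linear by (rule bounded_linear.linear)

text \<open>A maximising sequence for the Rayleigh form on the unit ball of \<open>W\<close>
  consists of approximate eigenvectors, since
  \<open>(norm (A u - L *\<^sub>R u))^2 \<le> L * (L - inner (A u) u)\<close> there; compactness
  makes a subsequence converge.\<close>

lemma top_eigenvector_exists:
  assumes sub: "subspace W" and cl: "closed W"
    and inv: "\<And>u. u \<in> W \<Longrightarrow> A u \<in> W"
    and ne: "w0 \<in> W" "w0 \<noteq> 0"
    and le: "\<And>u. u \<in> W \<Longrightarrow> inner (A u) u \<le> L * (norm u)\<^sup>2"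
    and sup: "\<And>e. 0 < e \<Longrightarrow> \<exists>u\<in>W. norm u \<le> 1 \<and> L - e < inner (A u) u"
  shows "\<exists>w\<in>W. w \<noteq> 0 \<and> A w = L *\<^sub>R w"
proof -
  have "0 \<le> L * (norm w0)\<^sup>2" using nonneg[of w0] le[OF ne(1)] by linarith
  then have L: "0 \<le> L" using ne(2) by (simp add: zero_le_mult_iff)
  have sq: "(norm (A u))\<^sup>2 \<le> L * inner (A u) u" if "u \<in> W" for u
    using norm_le_rayleigh[OF linear sub inv symmetric nonneg le that] .
  show ?thesis
  \<comment> \<open>For \<open>L = 0\<close> the bound \<open>sq\<close> gives
    \<open>A w0 = 0\<close>, so \<open>w0\<close> will do. Otherwise dividing by \<open>L\<close>
    recovers the limit of \<open>u (r k)\<close> from that of \<open>A (u (r k))\<close>.\<close>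
  proof (cases "L = 0")
    case True
    then show ?thesis using sq[OF ne(1)] ne by (intro bexI[of _ w0]) simp_all
  next
    case False
    then have "0 < L" using L by simp
    have "\<exists>u\<in>W. norm u \<le> 1 \<and> L - 1 / Suc k < inner (A u) u" for k by (rule sup) simp
    then obtain u where u: "\<And>k. u k \<in> W" "\<And>k. norm (u k) \<le> 1"
      "\<And>k. L - 1 / Suc k < inner (A (u k)) (u k)" by metis
    obtain r a where r: "strict_mono (r :: nat \<Rightarrow> nat)" and a: "(\<lambda>k. A (u (r k))) \<longlonglongrightarrow> a"
      using compact[of u] u(2) by blast
    have defect: "(norm (A (u k) - L *\<^sub>R u k))\<^sup>2 \<le> L * (1 / Suc k)" for k
    proof -
      have "(norm (A (u k) - L *\<^sub>R u k))\<^sup>2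
          = (norm (A (u k)))\<^sup>2 - 2 * L * inner (A (u k)) (u k) + L * (L * (norm (u k))\<^sup>2)"
        by (simp add: power2_norm_eq_inner inner_simps inner_commute algebra_simps)
      also have "\<dots> \<le> L * inner (A (u k)) (u k) - 2 * L * inner (A (u k)) (u k) + L * (L * 1)"
        using sq[OF u(1)[of k]] u(2)[of k] L
        by (intro add_mono diff_right_mono mult_left_mono) (auto simp: power_le_one)
      also have "\<dots> = L * (L - inner (A (u k)) (u k))" by (simp add: algebra_simps)
      also have "\<dots> \<le> L * (1 / Suc k)"
        using u(3)[of k] L by (intro mult_left_mono) auto
      finally show ?thesis .
    qed
    have "(\<lambda>k. L * (1 / Suc k)) \<longlonglongrightarrow> L * 0"
      by (intro tendsto_intros LIMSEQ_Suc lim_1_over_n)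
    then have "(\<lambda>k. L * (1 / Suc k)) \<longlonglongrightarrow> 0" by simp
    moreover have "\<forall>\<^sub>F k in sequentially. norm ((norm (A (u k) - L *\<^sub>R u k))\<^sup>2) \<le> L * (1 / Suc k)"
      using defect by (intro always_eventually allI) (simp del: of_nat_Suc)
    ultimately have "(\<lambda>k. (norm (A (u k) - L *\<^sub>R u k))\<^sup>2) \<longlonglongrightarrow> 0"
      by (rule Lim_null_comparison[rotated])
    from tendsto_real_sqrt[OF this] have "(\<lambda>k. norm (A (u k) - L *\<^sub>R u k)) \<longlonglongrightarrow> 0"
      by simp
    then have "(\<lambda>k. A (u k) - L *\<^sub>R u k) \<longlonglongrightarrow> 0" by (rule tendsto_norm_zero_cancel)
    then have "(\<lambda>k. A (u (r k)) - L *\<^sub>R u (r k)) \<longlonglongrightarrow> 0"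
      using LIMSEQ_subseq_LIMSEQ[OF _ r, of "\<lambda>k. A (u k) - L *\<^sub>R u k"] by (simp add: o_def)
    from tendsto_scaleR[OF tendsto_const[of "1 / L"] tendsto_diff[OF a this]]
    have ur: "(\<lambda>k. u (r k)) \<longlonglongrightarrow> (1 / L) *\<^sub>R a" using False by simp
    define w where "w = (1 / L) *\<^sub>R a"
    have Aw: "(\<lambda>k. A (u (r k))) \<longlonglongrightarrow> A w"
      unfolding w_def by (rule bounded_linear.tendsto[OF bounded_linear ur])
    then have "A w = a" using a LIMSEQ_unique by blast
    then have eig: "A w = L *\<^sub>R w" using False by (simp add: w_def)
    have "(\<lambda>k. L - 1 / Suc (r k)) \<longlonglongrightarrow> L - 0"
      by (intro tendsto_intros LIMSEQ_subseq_LIMSEQ[OF LIMSEQ_Suc[OF lim_1_over_n] r,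
            unfolded o_def])
    moreover have "(\<lambda>k. inner (A (u (r k))) (u (r k))) \<longlonglongrightarrow> inner (A w) w"
      by (intro tendsto_inner Aw ur[folded w_def])
    \<comment> \<open>The limit is not 0: the Rayleigh values converge to at least \<open>L\<close>,
      which is positive here.\<close>
    ultimately have "L - 0 \<le> inner (A w) w"
      by (rule LIMSEQ_le) (use u(3) in \<open>auto intro: less_imp_le\<close>)
    then have "w \<noteq> 0" using \<open>0 < L\<close> by auto
    moreover have "w \<in> W"
      unfolding w_def by (rule closed_sequentially[OF cl _ ur]) (rule u(1))
    ultimately show ?thesis using eig by blast
  qed
qed

end

text \<open>The Rayleigh bound on the orthogonal complement of the preceding vectors makes the
  eigenvalues the largest ones, in decreasing order.\<close>

definition top_eigen :: "('h::real_inner \<Rightarrow> 'h) \<Rightarrow> nat \<Rightarrow> (nat \<Rightarrow> 'h) \<Rightarrow> bool" where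
  "top_eigen A n v \<longleftrightarrow>
     (\<forall>i\<in>{1..n}. \<forall>j\<in>{1..n}. inner (v i) (v j) = (if i = j then 1 else 0)) \<and>
     (\<forall>i\<in>{1..n}. A (v i) = inner (A (v i)) (v i) *\<^sub>R v i \<and>
        (\<forall>u. (\<forall>j\<in>{1..<i}. inner u (v j) = 0) \<longrightarrow>
             inner (A u) u \<le> inner (A (v i)) (v i) * (norm u)\<^sup>2))"

context compact_positive
begin

text \<open>As a quadratic form, \<open>A\<close> is bounded by \<open>l n\<close> times the
  identity plus the sum of \<open>l i - l n\<close> times the squared coordinate along
  \<open>v i\<close>. Summed over the \<open>w j\<close>, the squared coordinates for each
  \<open>i\<close> add up to at most 1 by Bessel, and the coefficients \<open>l i - l n\<close> are
  nonnegative.\<close>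

lemma ky_fan:
  assumes v: "top_eigen A n v" and J: "finite J" "card J \<le> n"
    and w: "\<And>i j. i \<in> J \<Longrightarrow> j \<in> J \<Longrightarrow> inner (w i) (w j) = (if i = j then 1 else 0)"
  shows "(\<Sum>j\<in>J. inner (A (w j)) (w j)) \<le> (\<Sum>i=1..n. inner (A (v i)) (v i))"
\<comment> \<open>For \<open>n = 0\<close> the family \<open>J\<close> is empty; the main argument
  works with the last eigenvalue \<open>l n\<close>.\<close>
proof (cases "n = 0")
  case True
  then show ?thesis using J by simp
next
  case False
  define l where "l i = inner (A (v i)) (v i)" for i
  have orth: "\<And>i j. i \<in> {1..n} \<Longrightarrow> j \<in> {1..n} \<Longrightarrow> inner (v i) (v j) = (if i = j then 1 else 0)"
    and eig: "\<And>i. i \<in> {1..n} \<Longrightarrow> A (v i) = l i *\<^sub>R v i"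
    and ray: "\<And>i u. i \<in> {1..n} \<Longrightarrow> (\<And>j. j \<in> {1..<i} \<Longrightarrow> inner u (v j) = 0) \<Longrightarrow>
      inner (A u) u \<le> l i * (norm u)\<^sup>2"
    using v unfolding top_eigen_def l_def by blast+
  have l0: "0 \<le> l n" unfolding l_def by (rule nonneg)
  have ln: "l n \<le> l i" if "i \<in> {1..n}" for i
  proof -
    have "(norm (v n))\<^sup>2 = 1" using orth[of n n] False by (simp add: power2_norm_eq_inner)
    then show ?thesis
      using ray[OF that, of "v n"] orth[of n] that False by (auto simp: l_def)
  qed
  \<comment> \<open>Split \<open>x\<close> into its projection \<open>p\<close> and
    \<open>x - p\<close>. The cross term vanishes because \<open>A p\<close> is again a combination
    of the \<open>v i\<close>, and the Rayleigh bound with \<open>i = n\<close> controls the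
    rest.\<close>
  have bound: "inner (A x) x \<le> l n * (norm x)\<^sup>2 + (\<Sum>i=1..n. (l i - l n) * (inner x (v i))\<^sup>2)" for x
  proof -
    define p where "p = (\<Sum>i=1..n. inner x (v i) *\<^sub>R v i)"
    have rv: "inner (x - p) (v i) = 0" if "i \<in> {1..n}" for i
      unfolding p_def by (rule orthonormal_residual_orthogonal[OF _ orth that]) auto
    have Ap: "A p = (\<Sum>i=1..n. (inner x (v i) * l i) *\<^sub>R v i)"
      unfolding p_def by (simp add: linear_sum[OF linear] linear_scale[OF linear] eig)
    have "inner (A (x - p)) p = 0"
      unfolding symmetric[of "x - p" p] Ap by (simp add: inner_sum_right rv)
    moreover have "inner (A x) x = inner (A p) x + inner (A (x - p)) x"
      by (simp add: linear_diff[OF linear] inner_simps)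
    ultimately have "inner (A x) x = inner (A p) x + inner (A (x - p)) (x - p)"
      by (simp add: inner_simps)
    also have "inner (A p) x = (\<Sum>i=1..n. l i * (inner x (v i))\<^sup>2)"
      unfolding Ap by (simp add: inner_sum_left power2_eq_square inner_commute[of x] mult_ac)
    also have "inner (A (x - p)) (x - p) \<le> l n * (norm (x - p))\<^sup>2"
      by (rule ray) (use False rv in auto)
    also have "(norm (x - p))\<^sup>2 = (norm x)\<^sup>2 - (\<Sum>i=1..n. (inner x (v i))\<^sup>2)"
      unfolding p_def by (rule orthonormal_residual_norm[OF _ orth]) auto
    finally show ?thesis
      by (simp add: algebra_simps sum_subtractf sum_distrib_left)
  qed
  have wn: "(norm (w j))\<^sup>2 = 1" if "j \<in> J" for j
    using w[OF that that] by (simp add: power2_norm_eq_inner)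
  have "(\<Sum>j\<in>J. inner (A (w j)) (w j))
      \<le> (\<Sum>j\<in>J. l n * (norm (w j))\<^sup>2 + (\<Sum>i=1..n. (l i - l n) * (inner (w j) (v i))\<^sup>2))"
    by (rule sum_mono[OF bound])
  also have "\<dots> = card J * l n + (\<Sum>i=1..n. (l i - l n) * (\<Sum>j\<in>J. (inner (v i) (w j))\<^sup>2))"
    by (subst sum.distrib, subst sum.swap)
      (simp add: wn sum_distrib_left inner_commute)
  \<comment> \<open>The bound \<open>card J \<le> n\<close> enters through
    \<open>l n \<ge> 0\<close>, so families of fewer than \<open>n\<close> vectors are covered as
    well.\<close>
  also have "\<dots> \<le> n * l n + (\<Sum>i=1..n. (l i - l n) * 1)"
  proof (intro add_mono sum_mono mult_left_mono mult_right_mono)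
    fix i assume i: "i \<in> {1..n}"
    have "(\<Sum>j\<in>J. (inner (v i) (w j))\<^sup>2) \<le> (norm (v i))\<^sup>2"
      by (rule bessel_inequality[OF J(1) w])
    then show "(\<Sum>j\<in>J. (inner (v i) (w j))\<^sup>2) \<le> 1"
      using orth[OF i i] by (simp add: power2_norm_eq_inner)
    show "0 \<le> l i - l n" using ln[OF i] by simp
  qed (use J l0 in auto)
  also have "\<dots> = (\<Sum>i=1..n. l i)" by (simp add: sum_subtractf)
  finally show ?thesis by (simp add: l_def)
qed

end

section \<open>Measurable choice of eigenvectors\<close>

text \<open>A simple function in place of \<open>f\<close> takes finitely many values, so
  measurability for each fixed \<open>u\<close> suffices; continuity in the second argument passes
  to the limit.\<close>

lemma borel_measurable_caratheodory:
  fixes F :: "'x \<Rightarrow> 'a::{metric_space, second_countable_topology} \<Rightarrow> 'b::metric_space"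
  assumes meas: "\<And>u. (\<lambda>x. F x u) \<in> borel_measurable N"
    and cont: "\<And>x. x \<in> space N \<Longrightarrow> continuous_on UNIV (F x)"
    and f: "f \<in> borel_measurable N"
  shows "(\<lambda>x. F x (f x)) \<in> borel_measurable N"
proof -
  obtain s where s: "\<And>i. simple_function N (s i)"
    and lim: "\<And>x. x \<in> space N \<Longrightarrow> (\<lambda>i. s i x) \<longlonglongrightarrow> f x"
    using borel_measurable_implies_sequence_metric[OF f, of undefined] by blast
  have "(\<lambda>x. F x (s i x)) \<in> borel_measurable N" for i
  proof (rule measurable_compose_countable'[OF meas])
    have "finite (s i ` space N)" using s by (rule simple_functionD)
    then show "s i \<in> measurable N (count_space (s i ` space N))"
      using simple_functionD(2)[OF s] by (subst measurable_count_space_eq2) auto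
    show "countable (s i ` space N)" by (rule countable_finite) fact
  qed
  then show ?thesis
  proof (rule borel_measurable_LIMSEQ_metric)
    fix x assume "x \<in> space N"
    then show "(\<lambda>i. F x (s i x)) \<longlonglongrightarrow> F x (f x)"
      using continuous_on_tendsto_compose[OF cont lim] by auto
  qed
qed

section \<open>Deflation by the vectors already found\<close>

definition residual :: "nat \<Rightarrow> (nat \<Rightarrow> 'h::real_inner) \<Rightarrow> 'h \<Rightarrow> 'h" where
  "residual m v u = u - (\<Sum>i=1..m. inner u (v i) *\<^sub>R v i)"

text \<open>Since \<open>sgn 0 = 0\<close>, a vanishing residual gives the value 0 for linear
  \<open>A\<close>, which for positive \<open>A\<close> exceeds no Rayleigh quotient.\<close>

definition residual_rayleigh ::
    "('h::real_inner \<Rightarrow> 'h) \<Rightarrow> nat \<Rightarrow> (nat \<Rightarrow> 'h) \<Rightarrow> 'h \<Rightarrow> real" where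
  "residual_rayleigh A m v u = inner (A (sgn (residual m v u))) (sgn (residual m v u))"

lemma residual_nonzero_exists:
  assumes "enat m < edim (UNIV :: 'h::real_inner set)"
  shows "\<exists>u. residual m v u \<noteq> (0::'h)"
proof (rule ccontr)
  assume "\<not> ?thesis"
  then have eq: "u = (\<Sum>i=1..m. inner u (v i) *\<^sub>R v i)" for u by (simp add: residual_def)
  have "u \<in> span (v ` {1..m})" for u
    by (subst eq) (intro span_sum span_scale span_base, auto)
  then have sub: "UNIV \<subseteq> span (v ` {1..m})" by blast
  then have "dim (UNIV :: 'h set) \<le> card (v ` {1..m})" by (intro dim_le_card) auto
  also have "\<dots> \<le> m" using card_image_le[of "{1..m}" v] by simp
  finally have "edim (UNIV :: 'h set) \<le> enat m" using sub unfolding edim_def by auto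
  then show False using assms by simp
qed

context compact_positive
begin

text \<open>Adding the identity before normalising keeps the iteration meaningful when the top
  eigenvalue of the compression is \<open>0\<close>.\<close>

lemma deflated_power_iteration:
  fixes d :: "nat \<Rightarrow> 'h" and v :: "nat \<Rightarrow> 'h" and m :: nat
  defines "L \<equiv> SUP k. residual_rayleigh A m v (d k)"
  assumes dense: "closure (range d) = UNIV"
    and orth: "\<And>i j. i \<in> {1..m} \<Longrightarrow> j \<in> {1..m} \<Longrightarrow> inner (v i) (v j) = (if i = j then 1 else 0)"
    and eig: "\<And>i. i \<in> {1..m} \<Longrightarrow> A (v i) = l i *\<^sub>R v i"
    and dim: "enat m < edim (UNIV :: 'h set)"
  shows "bdd_above (range (\<lambda>k. residual_rayleigh A m v (d k)))" (is ?bdd)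
    and "\<And>u. (\<And>i. i \<in> {1..m} \<Longrightarrow> inner u (v i) = 0) \<Longrightarrow> inner (A u) u \<le> L * (norm u)\<^sup>2"
    and "\<exists>p. (\<forall>k. (\<lambda>j. ((\<lambda>u. (1 / (L + 1)) *\<^sub>R (A u + u)) ^^ j) (residual m v (d k))) \<longlonglongrightarrow> p k)
      \<and> (\<forall>k. A (p k) = L *\<^sub>R p k \<and> (\<forall>i\<in>{1..m}. inner (p k) (v i) = 0)) \<and> (\<exists>k. p k \<noteq> 0)"
proof -
  define W where "W = {u. \<forall>i\<in>{1..m}. inner u (v i) = 0}"
  have sub: "subspace W" unfolding W_def by (auto simp: subspace_def inner_simps)
  have cl: "closed W"
    unfolding W_def Collect_ball_eq by (intro closed_INT ballI closed_Collect_eq continuous_intros)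
  have RW: "residual m v u \<in> W" for u
    unfolding W_def residual_def by (auto intro!: orthonormal_residual_orthogonal orth)
  have Rid: "residual m v u = u" if "u \<in> W" for u
    using that unfolding residual_def W_def by simp
  have R_adj: "inner (residual m v u) w = inner u w" if "w \<in> W" for u w
    using that unfolding residual_def W_def
    by (simp add: inner_diff_left inner_sum_left) (simp add: inner_commute)
  \<comment> \<open>Symmetry moves \<open>A\<close> onto the eigenvectors \<open>v i\<close>, so
    their orthogonal complement is invariant.\<close>
  have inv: "A u \<in> W" if "u \<in> W" for u
    using that unfolding W_def by (simp add: symmetric eig)
  obtain K where K: "\<And>u. norm (A u) \<le> norm u * K"
    using bounded_linear.bounded[OF bounded_linear] by blast
  have "inner (A (sgn u)) (sgn u) \<le> \<bar>K\<bar>" for u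
  proof (cases "u = 0")
    case False
    then have "norm (sgn u) = 1" by (simp add: norm_sgn)
    then show ?thesis
      using norm_cauchy_schwarz[of "A (sgn u)" "sgn u"] K[of "sgn u"] by simp
  qed (simp add: linear_0[OF linear])
  then show bdd: ?bdd unfolding residual_rayleigh_def by (auto intro!: bdd_aboveI)
  have le_L: "residual_rayleigh A m v (d k) \<le> L" for k
    unfolding L_def by (rule cSUP_upper[OF _ bdd]) simp
  have L0: "0 \<le> L" using le_L[of 0] nonneg order_trans unfolding residual_rayleigh_def by blast
  have dense_closed: "u \<in> S" if "closed S" "\<And>k. d k \<in> S" for S u
    using closure_minimal[of "range d" S] that dense by auto
  have contA: "continuous_on S (\<lambda>u. A (g u))" if "continuous_on S g" for S and g :: "'h \<Rightarrow> 'h"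
    using bounded_linear.continuous_on[OF bounded_linear that] .
  have contR: "continuous_on S (residual m v)" for S
    unfolding residual_def by (intro continuous_intros)
  have scale_sgn: "u = norm u *\<^sub>R sgn u" for u :: 'h
    by (cases "u = 0") (simp_all add: sgn_div_norm)
  have sgn_W: "sgn u \<in> W" if "u \<in> W" for u
    unfolding sgn_div_norm by (rule subspace_scale[OF sub that])
  have at_d: "inner (A (residual m v (d k))) (residual m v (d k)) \<le> L * (norm (residual m v (d k)))\<^sup>2"
    for k
  proof -
    define r where "r = residual m v (d k)"
    have "inner (A r) r = inner (A (norm r *\<^sub>R sgn r)) (norm r *\<^sub>R sgn r)"
      using scale_sgn[of r] by simp
    also have "\<dots> = residual_rayleigh A m v (d k) * (norm r)\<^sup>2"
      unfolding residual_rayleigh_def r_def linear_scale[OF linear]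
      by (simp add: power2_eq_square)
    also have "\<dots> \<le> L * (norm r)\<^sup>2" by (intro mult_right_mono le_L) simp
    finally show ?thesis unfolding r_def .
  qed
  \<comment> \<open>The inequality is a closed condition on \<open>u\<close> and holds on the dense
    sequence, hence everywhere; as \<open>residual m v\<close> is the identity on \<open>W\<close>,
    it becomes the Rayleigh bound on \<open>W\<close>.\<close>
  have "inner (A (residual m v u)) (residual m v u) \<le> L * (norm (residual m v u))\<^sup>2" for u
    using dense_closed[of "{u. inner (A (residual m v u)) (residual m v u)
        \<le> L * (norm (residual m v u))\<^sup>2}"] at_d
    by (simp add: closed_Collect_le continuous_on_inner continuous_on_mult continuous_on_power
        continuous_on_norm contA contR)
  then have le: "inner (A u) u \<le> L * (norm u)\<^sup>2" if "u \<in> W" for u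
    using Rid[OF that] by metis
  then show "\<And>u. (\<And>i. i \<in> {1..m} \<Longrightarrow> inner u (v i) = 0) \<Longrightarrow> inner (A u) u \<le> L * (norm u)\<^sup>2"
    unfolding W_def by blast
  have attained: "\<exists>u\<in>W. norm u \<le> 1 \<and> L - e < inner (A u) u" if "0 < e" for e
  proof -
    obtain k where "L - e < residual_rayleigh A m v (d k)"
      using less_cSUP_iff[OF _ bdd, of "L - e"] \<open>0 < e\<close> unfolding L_def by auto
    then show ?thesis
      unfolding residual_rayleigh_def
      by (intro bexI[of _ "sgn (residual m v (d k))"] conjI)
        (simp_all add: norm_sgn sgn_W RW)
  qed
  obtain u0 where "residual m v u0 \<noteq> 0" using residual_nonzero_exists[OF dim] by blast
  then obtain e where e: "e \<in> W" "e \<noteq> 0" "A e = L *\<^sub>R e"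
    using top_eigenvector_exists[OF sub cl inv RW _ le attained] by blast
  define T where "T u = (1 / (L + 1)) *\<^sub>R (A u + u)" for u
  \<comment> \<open>The fixed space of \<open>T\<close> is the eigenspace of \<open>A\<close> for
    \<open>L\<close>; the factor \<open>L + 1\<close> is positive by \<open>L0\<close>.\<close>
  have T_fix: "T u = u \<longleftrightarrow> A u = L *\<^sub>R u" for u
  proof -
    have "T u = u \<longleftrightarrow> (L + 1) *\<^sub>R T u = (L + 1) *\<^sub>R u" using L0 by simp
    also have "(L + 1) *\<^sub>R T u = A u + u" using L0 by (simp add: T_def)
    finally show ?thesis by (simp add: scaleR_add_left)
  qed
  have "\<exists>p\<in>W. (\<lambda>j. (T ^^ j) u) \<longlonglongrightarrow> p \<and> T p = p \<and> (\<forall>w. T w = w \<longrightarrow> inner p w = inner u w)"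
    if "u \<in> W" for u
  proof (rule contraction_powers_tendsto_fixpoint[OF _ sub cl _ _ _ _ that])
    show "bounded_linear T" unfolding T_def
      by (intro bounded_linear_intros bounded_linear)
    show "T u \<in> W" if "u \<in> W" for u
      unfolding T_def by (intro subspace_scale[OF sub] subspace_add[OF sub] inv that)
    show "inner (T u) w = inner u (T w)" for u w
      by (simp add: T_def inner_simps symmetric)
    show "0 \<le> inner (T u) u" for u
      using L0 nonneg[of u] by (simp add: T_def inner_simps)
    show "inner (T u) u \<le> (norm u)\<^sup>2" if "u \<in> W" for u
    proof -
      have "inner (T u) u = (inner (A u) u + (norm u)\<^sup>2) / (L + 1)"
        by (simp add: T_def inner_add_left power2_norm_eq_inner)
      also have "\<dots> \<le> (norm u)\<^sup>2"
        using le[OF that] L0 by (simp add: pos_divide_le_eq algebra_simps)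
      finally show ?thesis .
    qed
  qed
  \<comment> \<open>The vector \<open>e\<close> is fixed by \<open>T\<close>, so the limit has the
    same inner product with \<open>e\<close> as the residual, and by \<open>R_adj\<close> the same
    as \<open>d k\<close> itself.\<close>
  then have "\<exists>p\<in>W. (\<lambda>j. (T ^^ j) (residual m v (d k))) \<longlonglongrightarrow> p \<and> A p = L *\<^sub>R p
      \<and> inner p e = inner (d k) e" for k
    using RW[of "d k"] R_adj[OF e(1)] e(3) T_fix by metis
  then obtain p where p: "\<And>k. p k \<in> W" "\<And>k. (\<lambda>j. (T ^^ j) (residual m v (d k))) \<longlonglongrightarrow> p k"
    "\<And>k. A (p k) = L *\<^sub>R p k" "\<And>k. inner (p k) e = inner (d k) e" by metis
  \<comment> \<open>If all limits vanished, \<open>e\<close> would be orthogonal to a dense sequence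
    and hence 0.\<close>
  have "\<exists>k. p k \<noteq> 0"
  proof (rule ccontr)
    assume "\<not> ?thesis"
    then have "inner (d k) e = 0" for k using p(4)[of k] by simp
    then have "inner e e = 0"
      using dense_closed[of "{u. inner u e = 0}"]
      by (simp add: closed_Collect_eq continuous_on_inner)
    then show False using e(2) by simp
  qed
  then show "\<exists>p. (\<forall>k. (\<lambda>j. ((\<lambda>u. (1 / (L + 1)) *\<^sub>R (A u + u)) ^^ j) (residual m v (d k))) \<longlonglongrightarrow> p k)
      \<and> (\<forall>k. A (p k) = L *\<^sub>R p k \<and> (\<forall>i\<in>{1..m}. inner (p k) (v i) = 0)) \<and> (\<exists>k. p k \<noteq> 0)"
    using p(1-3) unfolding T_def[abs_def] W_def by (intro exI[of _ p]) simp
qed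

end

lemma dense_sequence_exists:
  "\<exists>d :: nat \<Rightarrow> 'a::second_countable_topology. closure (range d) = UNIV"
proof -
  obtain D :: "'a set" where D: "countable D" "\<And>X. open X \<Longrightarrow> X \<noteq> {} \<Longrightarrow> \<exists>d\<in>D. d \<in> X"
    by (erule countable_dense_setE)
  then have "D \<noteq> {}" using D(2)[of UNIV] by auto
  then have "range (from_nat_into D) = D" using D(1) by (rule range_from_nat_into)
  moreover have "closure D = UNIV"
    using D(2)[of "- closure D"] closure_subset[of D] by auto
  ultimately show ?thesis by metis
qed

text \<open>One deflation step for all \<open>x\<close> at once. It is built from a countable
  supremum, compositions with \<open>A x\<close>, pointwise limits and a least index, each of which
  preserves measurability.\<close>

lemma measurable_next_eigenvector:
  fixes A :: "'x \<Rightarrow> 'h \<Rightarrow> 'h::{real_inner, complete_space, second_countable_topology}"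
  assumes A: "\<And>x. x \<in> space N \<Longrightarrow> compact_positive (A x)"
    and meas: "\<And>u. (\<lambda>x. A x u) \<in> borel_measurable N"
    and v [measurable]: "\<And>i. i \<in> {1..m} \<Longrightarrow> v i \<in> borel_measurable N"
    and top: "\<And>x. x \<in> space N \<Longrightarrow> top_eigen (A x) m (\<lambda>i. v i x)"
    and dim: "enat m < edim (UNIV :: 'h set)"
  shows "\<exists>w\<in>borel_measurable N. \<forall>x\<in>space N. inner (w x) (w x) = 1 \<and>
    (\<forall>i\<in>{1..m}. inner (w x) (v i x) = 0) \<and>
    A x (w x) = inner (A x (w x)) (w x) *\<^sub>R w x \<and>
    (\<forall>u. (\<forall>i\<in>{1..m}. inner u (v i x) = 0) \<longrightarrow>
      inner (A x u) u \<le> inner (A x (w x)) (w x) * (norm u)\<^sup>2)"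
proof -
  obtain d :: "nat \<Rightarrow> 'h" where d: "closure (range d) = UNIV"
    using dense_sequence_exists by blast
  define L where "L x = (SUP k. residual_rayleigh (A x) m (\<lambda>i. v i x) (d k))" for x
  define T where "T x u = (1 / (L x + 1)) *\<^sub>R (A x u + u)" for x u
  have orthonormal: "inner (v i x) (v j x) = (if i = j then 1 else 0)"
    if "x \<in> space N" "i \<in> {1..m}" "j \<in> {1..m}" for x i j
    using top[OF that(1)] that unfolding top_eigen_def by blast
  have eigenvector: "A x (v i x) = inner (A x (v i x)) (v i x) *\<^sub>R v i x"
    if "x \<in> space N" "i \<in> {1..m}" for x i
    using top[OF that(1)] that unfolding top_eigen_def by blast
  note step = compact_positive.deflated_power_iteration[OF A d orthonormal eigenvector dim, folded L_def]
  have bdd: "bdd_above (range (\<lambda>k. residual_rayleigh (A x) m (\<lambda>i. v i x) (d k)))"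
    if "x \<in> space N" for x
    by (rule step(1)) (simp_all add: that)
  have ray: "inner (A x u) u \<le> L x * (norm u)\<^sup>2"
    if "x \<in> space N" "\<forall>i\<in>{1..m}. inner u (v i x) = 0" for x u
    by (rule step(2)) (use that in blast)+
  have "\<exists>p. (\<forall>k. (\<lambda>j. (T x ^^ j) (residual m (\<lambda>i. v i x) (d k))) \<longlonglongrightarrow> p k)
      \<and> (\<forall>k. A x (p k) = L x *\<^sub>R p k \<and> (\<forall>i\<in>{1..m}. inner (p k) (v i x) = 0)) \<and> (\<exists>k. p k \<noteq> 0)"
    if "x \<in> space N" for x
  proof -
    have "T x = (\<lambda>u. (1 / (L x + 1)) *\<^sub>R (A x u + u))" by (simp add: T_def fun_eq_iff)
    then show ?thesis by (simp only:) (rule step(3), simp_all add: that)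
  qed
  \<comment> \<open>This choice is harmless for measurability: limits are unique, so
    \<open>p x k\<close> is the pointwise limit of the measurable iterates.\<close>
  from bchoice[OF ballI[OF this]] obtain p where p: "\<forall>x\<in>space N.
      (\<forall>k. (\<lambda>j. (T x ^^ j) (residual m (\<lambda>i. v i x) (d k))) \<longlonglongrightarrow> p x k)
      \<and> (\<forall>k. A x (p x k) = L x *\<^sub>R p x k \<and> (\<forall>i\<in>{1..m}. inner (p x k) (v i x) = 0))
      \<and> (\<exists>k. p x k \<noteq> 0)" ..
  have lim: "(\<lambda>j. (T x ^^ j) (residual m (\<lambda>i. v i x) (d k))) \<longlonglongrightarrow> p x k"
    and eig: "A x (p x k) = L x *\<^sub>R p x k"
    and orth: "i \<in> {1..m} \<Longrightarrow> inner (p x k) (v i x) = 0"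
    and nz: "\<exists>k. p x k \<noteq> 0"
    if "x \<in> space N" for x k i
    using bspec[OF p that] by simp_all
  have measA: "(\<lambda>x. A x (f x)) \<in> borel_measurable N" if "f \<in> borel_measurable N" for f
    using meas _ that
  proof (rule borel_measurable_caratheodory)
    show "continuous_on UNIV (A x)" if "x \<in> space N" for x
      using compact_positive.bounded_linear[OF A[OF that]] linear_continuous_on by blast
  qed
  have R [measurable]: "(\<lambda>x. residual m (\<lambda>i. v i x) (d k)) \<in> borel_measurable N" for k
    unfolding residual_def
    by (intro borel_measurable_diff borel_measurable_sum borel_measurable_scaleR
        borel_measurable_inner borel_measurable_const v)
  have sgn_meas: "(\<lambda>x. sgn (f x)) \<in> borel_measurable N" if [measurable]: "f \<in> borel_measurable N"
    for f :: "'x \<Rightarrow> 'h"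
    unfolding sgn_div_norm by measurable
  have L [measurable]: "L \<in> borel_measurable N"
    unfolding L_def
    by (intro borel_measurable_cSUP bdd)
      (auto simp: residual_rayleigh_def intro!: borel_measurable_inner measA sgn_meas R)
  have "(\<lambda>x. (T x ^^ j) (residual m (\<lambda>i. v i x) (d k))) \<in> borel_measurable N" for j k
  proof (induction j)
    case (Suc j)
    note Suc [measurable] and measA[OF Suc, measurable]
    show ?case unfolding funpow.simps o_apply T_def[of _ "(T _ ^^ j) _"] by measurable
  qed simp
  from borel_measurable_LIMSEQ_metric[OF this lim]
  have P [measurable]: "(\<lambda>x. p x k) \<in> borel_measurable N" for k .
  \<comment> \<open>The least index with a nonzero limit exists by \<open>nz\<close> and is a
    measurable function into the naturals.\<close>
  define w where "w x = sgn (p x (LEAST k. p x k \<noteq> 0))" for x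
  have "(\<lambda>x. LEAST k. p x k \<noteq> 0) \<in> measurable N (count_space UNIV)"
    by (intro measurable_Least) measurable
  then have w_meas: "w \<in> borel_measurable N"
    unfolding w_def by (intro sgn_meas measurable_compose_countable[OF P])
  show ?thesis
  proof (intro bexI[OF _ w_meas] ballI)
    fix x assume x: "x \<in> space N"
    define q where "q = p x (LEAST k. p x k \<noteq> 0)"
    have "q \<noteq> 0" unfolding q_def using nz[OF x] by (rule LeastI_ex)
    moreover have wq: "w x = (1 / norm q) *\<^sub>R q" unfolding w_def q_def by (simp add: sgn_div_norm inverse_eq_divide)
    ultimately have unit: "inner (w x) (w x) = 1"
      by (simp add: power2_norm_eq_inner[symmetric] power2_eq_square)
    have "A x (w x) = L x *\<^sub>R w x"
      unfolding wq linear_scale[OF compact_positive.linear[OF A[OF x]]]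
      by (simp add: q_def eig[OF x])
    then show "inner (w x) (w x) = 1 \<and> (\<forall>i\<in>{1..m}. inner (w x) (v i x) = 0) \<and>
      A x (w x) = inner (A x (w x)) (w x) *\<^sub>R w x \<and>
      (\<forall>u. (\<forall>i\<in>{1..m}. inner u (v i x) = 0) \<longrightarrow>
        inner (A x u) u \<le> inner (A x (w x)) (w x) * (norm u)\<^sup>2)"
      using unit ray[OF x] orth[OF x] by (simp add: wq q_def)
  qed
qed

lemma measurable_top_eigen:
  fixes A :: "'x \<Rightarrow> 'h \<Rightarrow> 'h::{real_inner, complete_space, second_countable_topology}"
  assumes A: "\<And>x. x \<in> space N \<Longrightarrow> compact_positive (A x)"
    and meas: "\<And>u. (\<lambda>x. A x u) \<in> borel_measurable N"
    and dim: "enat n \<le> edim (UNIV :: 'h set)"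
  shows "\<exists>v. (\<forall>i\<in>{1..n}. v i \<in> borel_measurable N) \<and>
    (\<forall>x\<in>space N. top_eigen (A x) n (\<lambda>i. v i x))"
  using dim
proof (induction n)
  case 0
  then show ?case by (simp add: top_eigen_def)
next
  case (Suc n)
  then have lt: "enat n < edim (UNIV :: 'h set)"
    by (metis Suc_ile_eq)
  then obtain v where v: "\<And>i. i \<in> {1..n} \<Longrightarrow> v i \<in> borel_measurable N"
    and top: "\<And>x. x \<in> space N \<Longrightarrow> top_eigen (A x) n (\<lambda>i. v i x)"
    using Suc.IH[OF less_imp_le[OF lt]] by blast
  from measurable_next_eigenvector[OF A meas v top lt]
  obtain w where w: "w \<in> borel_measurable N"
    and unit: "\<And>x. x \<in> space N \<Longrightarrow> inner (w x) (w x) = 1"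
    and orth: "\<And>x i. x \<in> space N \<Longrightarrow> i \<in> {1..n} \<Longrightarrow> inner (w x) (v i x) = 0"
    and eig: "\<And>x. x \<in> space N \<Longrightarrow> A x (w x) = inner (A x (w x)) (w x) *\<^sub>R w x"
    and ray: "\<And>x u. x \<in> space N \<Longrightarrow> (\<forall>i\<in>{1..n}. inner u (v i x) = 0) \<Longrightarrow>
      inner (A x u) u \<le> inner (A x (w x)) (w x) * (norm u)\<^sup>2"
    by blast
  have set_eq: "{1..Suc n} = insert (Suc n) {1..n}" by auto
  \<comment> \<open>Appending a vector leaves the earlier clauses intact, because the Rayleigh bound
    at \<open>i\<close> refers only to vectors before \<open>i\<close>.\<close>
  have "top_eigen (A x) (Suc n) (\<lambda>i. (v(Suc n := w)) i x)" if x: "x \<in> space N" for x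
  proof -
    have "{1..<Suc n} = {1..n}" by auto
    then show ?thesis
      using top[OF x] unit[OF x] orth[OF x] ray[OF x] eig[OF x]
      unfolding top_eigen_def set_eq by (auto simp: inner_commute)
  qed
  moreover have "(v(Suc n := w)) i \<in> borel_measurable N" if "i \<in> {1..Suc n}" for i
    using v w that by auto
  ultimately show ?case by blast
qed

section \<open>Covariance operators\<close>

lemma L2_funD:
  assumes "X \<in> L2_fun M"
  shows "X \<in> borel_measurable M" and "integrable M (\<lambda>s. (norm (X s))\<^sup>2)"
  using assms unfolding L2_fun_def by auto

lemma L2_fun_bound:
  assumes "Y \<in> borel_measurable M" and "X \<in> L2_fun M" and "Z \<in> L2_fun M"
    and "\<And>s. norm (Y s) \<le> norm (X s) + norm (Z s)"
  shows "Y \<in> L2_fun M"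
proof -
  have "integrable M (\<lambda>s. (norm (Y s))\<^sup>2)"
  proof (rule Bochner_Integration.integrable_bound)
    show "integrable M (\<lambda>s. 2 * (norm (X s))\<^sup>2 + 2 * (norm (Z s))\<^sup>2)"
      using L2_funD[OF assms(2)] L2_funD[OF assms(3)] by simp
    show "(\<lambda>s. (norm (Y s))\<^sup>2) \<in> borel_measurable M" using assms(1) by measurable
    have "(norm (Y s))\<^sup>2 \<le> 2 * (norm (X s))\<^sup>2 + 2 * (norm (Z s))\<^sup>2" for s
    proof -
      have "(norm (Y s))\<^sup>2 \<le> (norm (X s) + norm (Z s))\<^sup>2" by (intro power_mono assms(4)) simp
      also have "\<dots> \<le> 2 * (norm (X s))\<^sup>2 + 2 * (norm (Z s))\<^sup>2"
        using zero_le_power2[of "norm (X s) - norm (Z s)"]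
        by (simp add: power2_eq_square algebra_simps)
      finally show ?thesis .
    qed
    then show "AE s in M. norm ((norm (Y s))\<^sup>2) \<le> norm (2 * (norm (X s))\<^sup>2 + 2 * (norm (Z s))\<^sup>2)"
      by simp
  qed
  then show ?thesis using assms(1) by (simp add: L2_fun_def)
qed

lemma L2_fun_zero: "(\<lambda>s. 0) \<in> L2_fun M"
  by (simp add: L2_fun_def)

lemma L2_fun_diff:
  assumes "X \<in> L2_fun M" and "Y \<in> L2_fun M"
  shows "(\<lambda>s. X s - Y s) \<in> L2_fun M"
  by (rule L2_fun_bound[OF _ assms])
    (use assms[THEN L2_funD(1)] in \<open>auto simp: norm_triangle_ineq4\<close>)

lemma L2_norm_nonneg: "0 \<le> L2_norm M X"
  by (simp add: L2_norm_def)

lemma L2_norm_power2: "(L2_norm M X)\<^sup>2 = (\<integral>s. (norm (X s))\<^sup>2 \<partial>M)"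
  by (simp add: L2_norm_def)

text \<open>Cauchy-Schwarz for the real functions \<open>norm (X s)\<close> and
  \<open>norm (Y s)\<close>: the integral of \<open>(norm (X s) + t * norm (Y s))^2\<close> is a
  nonnegative quadratic in \<open>t\<close>.\<close>

lemma L2_fun_norm_mult:
  assumes "X \<in> L2_fun M" and "Y \<in> L2_fun M"
  shows "integrable M (\<lambda>s. norm (X s) * norm (Y s))"
    and "(\<integral>s. norm (X s) * norm (Y s) \<partial>M) \<le> L2_norm M X * L2_norm M Y"
proof -
  note [measurable] = assms[THEN L2_funD(1)]
  have int: "integrable M (\<lambda>s. (norm (X s))\<^sup>2)" "integrable M (\<lambda>s. (norm (Y s))\<^sup>2)"
    using assms by (auto dest: L2_funD)
  show prod: "integrable M (\<lambda>s. norm (X s) * norm (Y s))"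
  proof (rule Bochner_Integration.integrable_bound)
    show "integrable M (\<lambda>s. (norm (X s))\<^sup>2 + (norm (Y s))\<^sup>2)" using int by simp
    have "a * b \<le> a\<^sup>2 + b\<^sup>2" if "0 \<le> a" "0 \<le> b" for a b :: real
      using mult_nonneg_nonneg[OF that] sum_squares_bound[of a b] by linarith
    then show "AE s in M. norm (norm (X s) * norm (Y s)) \<le> norm ((norm (X s))\<^sup>2 + (norm (Y s))\<^sup>2)"
      by (simp add: abs_of_nonneg)
  qed measurable
  have "0 \<le> (L2_norm M X)\<^sup>2 + 2 * t * (\<integral>s. norm (X s) * norm (Y s) \<partial>M) + t\<^sup>2 * (L2_norm M Y)\<^sup>2"
    for t
  proof -
    have "0 \<le> (\<integral>s. (norm (X s) + t * norm (Y s))\<^sup>2 \<partial>M)" by simp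
    also have "(\<lambda>s. (norm (X s) + t * norm (Y s))\<^sup>2) =
        (\<lambda>s. (norm (X s))\<^sup>2 + 2 * t * (norm (X s) * norm (Y s)) + t\<^sup>2 * (norm (Y s))\<^sup>2)"
      by (simp add: power2_eq_square algebra_simps)
    finally show ?thesis using int prod by (simp add: L2_norm_power2)
  qed
  from nonneg_quadratic_discriminant[OF _ this]
  have "(\<integral>s. norm (X s) * norm (Y s) \<partial>M)\<^sup>2 \<le> (L2_norm M X * L2_norm M Y)\<^sup>2"
    by (simp add: power_mult_distrib)
  then show "(\<integral>s. norm (X s) * norm (Y s) \<partial>M) \<le> L2_norm M X * L2_norm M Y"
    by (rule power2_le_imp_le) (simp add: L2_norm_nonneg)
qed

lemma inner_mult_inner_le:
  "\<bar>inner x u * inner y w\<bar> \<le> norm u * norm w * (norm x * norm y)"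
proof -
  have "\<bar>inner x u\<bar> * \<bar>inner y w\<bar> \<le> (norm x * norm u) * (norm y * norm w)"
    by (intro mult_mono Cauchy_Schwarz_ineq2) auto
  then show ?thesis by (simp add: abs_mult mult_ac)
qed

lemma L2_fun_inner_mult_integrable:
  assumes "X \<in> L2_fun M" and "Y \<in> L2_fun M"
  shows "integrable M (\<lambda>s. inner (X s) u * inner (Y s) w)"
proof (rule Bochner_Integration.integrable_bound)
  show "integrable M (\<lambda>s. norm u * norm w * (norm (X s) * norm (Y s)))"
    using L2_fun_norm_mult(1)[OF assms] by simp
  show "(\<lambda>s. inner (X s) u * inner (Y s) w) \<in> borel_measurable M"
    using assms[THEN L2_funD(1)] by measurable
  show "AE s in M. norm (inner (X s) u * inner (Y s) w)
      \<le> norm (norm u * norm w * (norm (X s) * norm (Y s)))"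
    unfolding real_norm_def by (intro AE_I2 order_trans[OF inner_mult_inner_le abs_ge_self])
qed

text \<open>With \<open>D = X - Y\<close>, expanding \<open>X = D + Y\<close> cancels the pure
  \<open>Y\<close> term and leaves three products containing \<open>D\<close>. Continuity in the
  \<open>L2_norm\<close> rests on this estimate, both for the operators and for the eigenvalue
  sums.\<close>

lemma second_moment_diff_le:
  assumes X: "X \<in> L2_fun M" and Y: "Y \<in> L2_fun M"
  defines "t \<equiv> L2_norm M (\<lambda>s. X s - Y s)"
  shows "\<bar>(\<integral>s. inner (X s) u * inner (X s) w \<partial>M) - (\<integral>s. inner (Y s) u * inner (Y s) w \<partial>M)\<bar>
    \<le> norm u * norm w * (t\<^sup>2 + 2 * t * L2_norm M Y)"
proof -
  define D where "D s = X s - Y s" for s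
  have D: "D \<in> L2_fun M" unfolding D_def using L2_fun_diff[OF X Y] .
  have t: "t = L2_norm M D" by (simp add: t_def D_def[abs_def])
  have "(\<integral>s. inner (X s) u * inner (X s) w \<partial>M) - (\<integral>s. inner (Y s) u * inner (Y s) w \<partial>M)
      = (\<integral>s. inner (X s) u * inner (X s) w - inner (Y s) u * inner (Y s) w \<partial>M)"
    using L2_fun_inner_mult_integrable[OF X X] L2_fun_inner_mult_integrable[OF Y Y] by simp
  also have "\<bar>\<dots>\<bar> \<le> (\<integral>s. \<bar>inner (X s) u * inner (X s) w - inner (Y s) u * inner (Y s) w\<bar> \<partial>M)"
    by (rule integral_abs_bound)
  also have "\<dots> \<le> (\<integral>s. norm u * norm w * ((norm (D s))\<^sup>2 + 2 * (norm (D s) * norm (Y s))) \<partial>M)"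
  proof (rule integral_mono)
    show "integrable M (\<lambda>s. \<bar>inner (X s) u * inner (X s) w - inner (Y s) u * inner (Y s) w\<bar>)"
      using L2_fun_inner_mult_integrable[OF X X] L2_fun_inner_mult_integrable[OF Y Y] by simp
    show "integrable M (\<lambda>s. norm u * norm w * ((norm (D s))\<^sup>2 + 2 * (norm (D s) * norm (Y s))))"
      using L2_funD(2)[OF D] L2_fun_norm_mult(1)[OF D Y] by simp
    fix s
    have "X s = D s + Y s" by (simp add: D_def)
    then have "inner (X s) u * inner (X s) w - inner (Y s) u * inner (Y s) w
        = inner (D s) u * inner (D s) w + inner (D s) u * inner (Y s) w + inner (Y s) u * inner (D s) w"
      by (simp add: inner_add_left algebra_simps)
    also have "\<bar>\<dots>\<bar> \<le> norm u * norm w * (norm (D s) * norm (D s))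
        + norm u * norm w * (norm (D s) * norm (Y s)) + norm u * norm w * (norm (Y s) * norm (D s))"
      by (intro order_trans[OF abs_triangle_ineq] add_mono inner_mult_inner_le)
    finally show "\<bar>inner (X s) u * inner (X s) w - inner (Y s) u * inner (Y s) w\<bar>
        \<le> norm u * norm w * ((norm (D s))\<^sup>2 + 2 * (norm (D s) * norm (Y s)))"
      by (simp add: power2_eq_square algebra_simps)
  qed
  also have "\<dots> = norm u * norm w * (t\<^sup>2 + 2 * (\<integral>s. norm (D s) * norm (Y s) \<partial>M))"
    using L2_funD(2)[OF D] L2_fun_norm_mult(1)[OF D Y]
    by (simp add: t L2_norm_power2)
  also have "\<dots> \<le> norm u * norm w * (t\<^sup>2 + 2 * (t * L2_norm M Y))"
    using L2_fun_norm_mult(2)[OF D Y]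
    by (intro mult_left_mono add_left_mono) (auto simp: t)
  finally show ?thesis by (simp add: mult.assoc)
qed

lemma second_moment_le:
  assumes "X \<in> L2_fun M"
  shows "\<bar>\<integral>s. inner (X s) u * inner (X s) w \<partial>M\<bar> \<le> norm u * norm w * (L2_norm M X)\<^sup>2"
  using second_moment_diff_le[OF assms L2_fun_zero, of u w] by (simp add: L2_norm_def)

text \<open>Defined weakly, through the Riesz representation: the sort of \<open>'h\<close> does not contain the class
  \<^class>\<open>banach\<close>, so the theory of the Bochner integral of \<open>inner (X s) u *\<^sub>R X s\<close> is not available.\<close>

definition covariance ::
    "'s measure \<Rightarrow> ('s \<Rightarrow> 'h::{real_inner, complete_space, second_countable_topology}) \<Rightarrow> 'h \<Rightarrow> 'h" where
  "covariance M X u = (SOME a. \<forall>w. inner a w = (\<integral>s. inner (X s) u * inner (X s) w \<partial>M))"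

text \<open>Square integrability makes the right-hand side a bounded linear functional of
  \<open>w\<close>, so Riesz supplies the vector that \<open>SOME\<close> picks.\<close>

lemma inner_covariance:
  assumes X: "X \<in> L2_fun M"
  shows "inner (covariance M X u) w = (\<integral>s. inner (X s) u * inner (X s) w \<partial>M)"
proof -
  have "bounded_linear (\<lambda>w. \<integral>s. inner (X s) u * inner (X s) w \<partial>M)"
  proof (rule bounded_linear_intro)
    note int = L2_fun_inner_mult_integrable[OF X X]
    show "(\<integral>s. inner (X s) u * inner (X s) (x + y) \<partial>M)
        = (\<integral>s. inner (X s) u * inner (X s) x \<partial>M) + (\<integral>s. inner (X s) u * inner (X s) y \<partial>M)" for x y
      by (simp add: inner_add_right distrib_left int)
    show "(\<integral>s. inner (X s) u * inner (X s) (r *\<^sub>R x) \<partial>M)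
        = r *\<^sub>R (\<integral>s. inner (X s) u * inner (X s) x \<partial>M)" for r x
      by (simp add: mult.left_commute)
    show "norm (\<integral>s. inner (X s) u * inner (X s) x \<partial>M) \<le> norm x * (norm u * (L2_norm M X)\<^sup>2)" for x
      using second_moment_le[OF X, of u x] by (simp add: mult_ac)
  qed
  from riesz_representation[OF this]
  have "\<exists>a. \<forall>w. inner a w = (\<integral>s. inner (X s) u * inner (X s) w \<partial>M)" by metis
  from someI_ex[OF this] show ?thesis unfolding covariance_def by blast
qed

text \<open>A diagonal subsequence settles a dense sequence of test vectors; density and the bound
  on the \<open>u k\<close> extend convergence to all \<open>x\<close>. The later use is pointwise,
  with \<open>x = X s\<close>, so it is the convergence of the scalar products that is
  recorded.\<close>

lemma weakly_convergent_subsequence: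
  fixes u :: "nat \<Rightarrow> 'h::{real_inner, second_countable_topology}"
  assumes "\<And>k. norm (u k) \<le> 1"
  shows "\<exists>r. strict_mono (r :: nat \<Rightarrow> nat) \<and> (\<forall>x. convergent (\<lambda>k. inner x (u (r k))))"
proof -
  obtain d :: "nat \<Rightarrow> 'h" where d: "closure (range d) = UNIV" using dense_sequence_exists by blast
  have le: "\<bar>inner x (u k)\<bar> \<le> norm x" for x k
    using Cauchy_Schwarz_ineq2[of x "u k"] mult_left_mono[OF assms[of k], of "norm x"] by simp
  \<comment> \<open>Normalising the test vectors provides the common bound 1 that the diagonal
    argument asks for; \<open>conv_d\<close> undoes it.\<close>
  have "norm (inner (sgn (d i)) (u k)) \<le> 1" for i k
    using le[of "sgn (d i)" k] by (auto simp: norm_sgn split: if_splits)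
  then obtain r where r: "strict_mono (r :: nat \<Rightarrow> nat)"
    and lim: "\<And>i. \<exists>l. (\<lambda>k. inner (sgn (d i)) (u (r k))) \<longlonglongrightarrow> l"
    by (rule function_convergent_subsequence[of UNIV "\<lambda>k i. inner (sgn (d i)) (u k)" 1, OF countableI_type])
      auto
  have conv_d: "Cauchy (\<lambda>k. inner (d i) (u (r k)))" for i
  proof -
    obtain l where "(\<lambda>k. inner (sgn (d i)) (u (r k))) \<longlonglongrightarrow> l" using lim by blast
    then have "(\<lambda>k. norm (d i) * inner (sgn (d i)) (u (r k))) \<longlonglongrightarrow> norm (d i) * l"
      by (intro tendsto_intros)
    moreover have "norm (d i) * inner (sgn (d i)) y = inner (d i) y" for y
      by (cases "d i = 0") (simp_all add: sgn_div_norm)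
    ultimately show ?thesis using LIMSEQ_imp_Cauchy by simp
  qed
  have "Cauchy (\<lambda>k. inner x (u (r k)))" for x
  proof (rule metric_CauchyI)
    fix e :: real assume "0 < e"
    have "x \<in> closure (range d)" using d by simp
    then obtain i where i: "dist (d i) x < e / 3"
      using \<open>0 < e\<close> unfolding closure_approachable by (metis divide_pos_pos rangeE zero_less_numeral)
    obtain K where K: "\<And>k l. K \<le> k \<Longrightarrow> K \<le> l \<Longrightarrow>
        dist (inner (d i) (u (r k))) (inner (d i) (u (r l))) < e / 3"
      using metric_CauchyD[OF conv_d[of i], of "e / 3"] \<open>0 < e\<close> by auto
    have near: "\<bar>inner x (u (r k)) - inner (d i) (u (r k))\<bar> < e / 3" for k
      using le[of "x - d i" "r k"] i by (simp add: inner_diff_left dist_norm norm_minus_commute)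
    have "dist (inner x (u (r k))) (inner x (u (r l))) < e" if "K \<le> k" "K \<le> l" for k l
      using K[OF that] near[of k] near[of l] unfolding dist_real_def by linarith
    then show "\<exists>M. \<forall>m\<ge>M. \<forall>n\<ge>M. dist (inner x (u (r m))) (inner x (u (r n))) < e" by blast
  qed
  then show ?thesis using r Cauchy_convergent by blast
qed

text \<open>The main point is compactness. Along a weakly convergent subsequence
  \<open>inner (X s) (x (r k))\<close> converges for every \<open>s\<close> and is dominated by
  \<open>norm (X s)\<close>, hence converges in mean square; \<open>sq\<close> turns this into a
  Cauchy sequence of images.\<close>

lemma compact_positive_covariance:
  assumes X: "X \<in> L2_fun M"
  shows "compact_positive (covariance M X)"
proof -
  let ?C = "covariance M X"
  note int = L2_fun_inner_mult_integrable[OF X X]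
  note inner_C = inner_covariance[OF X]
  have ext: "a = b" if "\<And>w. inner a w = inner b w" for a b :: 'b
    using that vector_eq_rdot by blast
  have sym: "inner (?C u) w = inner u (?C w)" for u w
    using inner_C[of u w] inner_C[of w u] by (simp add: inner_commute mult.commute)
  have pos: "0 \<le> inner (?C u) u" for u
    unfolding inner_C by (intro integral_nonneg_AE) simp
  have le: "inner (?C u) u \<le> (L2_norm M X)\<^sup>2 * (norm u)\<^sup>2" for u
    using second_moment_le[OF X, of u u] by (simp add: inner_C power2_eq_square mult_ac)
  have add: "?C (u + w) = ?C u + ?C w" for u w
    by (rule ext) (simp add: inner_C inner_add_left inner_add_right distrib_right int)
  have scale: "?C (c *\<^sub>R u) = c *\<^sub>R ?C u" for c u
    by (rule ext) (simp add: inner_C mult.assoc)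
  have lin: "linear ?C" by (rule linearI[OF add scale])
  have sq: "(norm (?C u))\<^sup>2 \<le> (L2_norm M X)\<^sup>2 * inner (?C u) u" for u
    using norm_le_rayleigh[OF lin subspace_UNIV _ sym pos le] by simp
  show ?thesis
  proof (rule compact_positive.intro)
    show "bounded_linear ?C"
    proof (rule bounded_linear_intro[OF add scale])
      fix u
      have "(norm (?C u))\<^sup>2 \<le> (L2_norm M X)\<^sup>2 * ((L2_norm M X)\<^sup>2 * (norm u)\<^sup>2)"
        by (intro order_trans[OF sq] mult_left_mono le) simp
      also have "\<dots> = (norm u * (L2_norm M X)\<^sup>2)\<^sup>2" by (simp add: power2_eq_square mult_ac)
      finally show "norm (?C u) \<le> norm u * (L2_norm M X)\<^sup>2" by (rule power2_le_imp_le) simp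
    qed
    show "inner (?C u) w = inner u (?C w)" for u w by (rule sym)
    show "0 \<le> inner (?C u) u" for u by (rule pos)
    fix x :: "nat \<Rightarrow> 'b" assume x: "\<And>k. norm (x k) \<le> 1"
    obtain r where r: "strict_mono (r :: nat \<Rightarrow> nat)"
      and conv: "\<And>y. convergent (\<lambda>k. inner y (x (r k)))"
      using weakly_convergent_subsequence[of x] x by blast
    define g where "g s = lim (\<lambda>k. inner (X s) (x (r k)))" for s
    have g: "(\<lambda>k. inner (X s) (x (r k))) \<longlonglongrightarrow> g s" for s
      unfolding g_def using conv by (simp add: convergent_LIMSEQ_iff)
    have [measurable]: "X \<in> borel_measurable M" by (rule L2_funD(1)[OF X])
    have [measurable]: "g \<in> borel_measurable M"
      by (rule borel_measurable_LIMSEQ_metric[OF _ g]) measurable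
    have le_norm: "\<bar>inner (X s) (x (r k))\<bar> \<le> norm (X s)" for s k
      using Cauchy_Schwarz_ineq2[of "X s" "x (r k)"] mult_left_mono[OF x[of "r k"], of "norm (X s)"]
      by simp
    have g_le: "\<bar>g s\<bar> \<le> norm (X s)" for s
      by (rule LIMSEQ_le_const2[OF tendsto_rabs[OF g]]) (use le_norm in auto)
    \<comment> \<open>Squared distance to the pointwise limit \<open>g\<close>. Both terms of the
      difference are bounded by \<open>norm (X s)\<close>, whence the dominating function
      \<open>4 * (norm (X s))^2\<close>.\<close>
    define h where "h k s = (inner (X s) (x (r k)) - g s)\<^sup>2" for k s
    have [measurable]: "h k \<in> borel_measurable M" for k unfolding h_def by measurable
    have h_le: "norm (h k s) \<le> 4 * (norm (X s))\<^sup>2" for k s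
    proof -
      have "\<bar>inner (X s) (x (r k)) - g s\<bar> \<le> 2 * norm (X s)"
        using le_norm[of s k] g_le[of s] by linarith
      then have "\<bar>inner (X s) (x (r k)) - g s\<bar>\<^sup>2 \<le> (2 * norm (X s))\<^sup>2" by (intro power_mono) auto
      then show ?thesis by (simp add: h_def)
    qed
    have dom: "integrable M (\<lambda>s. 4 * (norm (X s))\<^sup>2)" using L2_funD(2)[OF X] by simp
    have h_int: "integrable M (h k)" for k
      by (rule Bochner_Integration.integrable_bound[OF dom]) (use h_le in auto)
    have "(\<lambda>k. h k s) \<longlonglongrightarrow> (g s - g s)\<^sup>2" for s
      unfolding h_def by (intro tendsto_intros g)
    then have "(\<lambda>k. \<integral>s. h k s \<partial>M) \<longlonglongrightarrow> (\<integral>s. 0 \<partial>M)"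
      by (intro integral_dominated_convergence[OF _ _ dom]) (use h_le in auto)
    then have h0: "(\<lambda>k. \<integral>s. h k s \<partial>M) \<longlonglongrightarrow> 0" by simp
    have diff: "(norm (?C (x (r k)) - ?C (x (r l))))\<^sup>2
        \<le> (L2_norm M X)\<^sup>2 * (2 * (\<integral>s. h k s \<partial>M) + 2 * (\<integral>s. h l s \<partial>M))" for k l
    proof -
      have "inner (?C (x (r k) - x (r l))) (x (r k) - x (r l))
          \<le> (\<integral>s. 2 * h k s + 2 * h l s \<partial>M)"
        unfolding inner_C
      proof (rule integral_mono[OF int])
        show "integrable M (\<lambda>s. 2 * h k s + 2 * h l s)" using h_int by simp
        fix s
        have "(a - b)\<^sup>2 \<le> 2 * (a - c)\<^sup>2 + 2 * (b - c)\<^sup>2" for a b c :: real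
          using zero_le_power2[of "a + b - 2 * c"] by (simp add: power2_eq_square algebra_simps)
        then show "inner (X s) (x (r k) - x (r l)) * inner (X s) (x (r k) - x (r l))
            \<le> 2 * h k s + 2 * h l s"
          by (simp add: h_def inner_diff_right power2_eq_square[symmetric])
      qed
      also have "\<dots> = 2 * (\<integral>s. h k s \<partial>M) + 2 * (\<integral>s. h l s \<partial>M)" using h_int by simp
      finally show ?thesis
        unfolding linear_diff[OF lin, symmetric]
        by (intro order_trans[OF sq] mult_left_mono) auto
    qed
    have "Cauchy (\<lambda>k. ?C (x (r k)))"
    proof (rule metric_CauchyI)
      fix e :: real assume "0 < e"
      \<comment> \<open>The summand 1 keeps \<open>c\<close> positive when the norm vanishes and
        leaves the slack \<open>q\<close> for a strict inequality.\<close>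
      define c where "c = 4 * (L2_norm M X)\<^sup>2 + 1"
      have "0 < c" unfolding c_def by (simp add: add_nonneg_pos)
      define q where "q = e\<^sup>2 / c"
      have "0 < q" and cq: "c * q = e\<^sup>2" using \<open>0 < e\<close> \<open>0 < c\<close> by (simp_all add: q_def)
      from LIMSEQ_D[OF h0 \<open>0 < q\<close>] obtain K where K: "\<And>k. K \<le> k \<Longrightarrow> (\<integral>s. h k s \<partial>M) < q"
        by (auto simp: abs_less_iff)
      have "dist (?C (x (r k))) (?C (x (r l))) < e" if "K \<le> k" "K \<le> l" for k l
      proof -
        have "(norm (?C (x (r k)) - ?C (x (r l))))\<^sup>2
            \<le> (L2_norm M X)\<^sup>2 * (2 * q + 2 * q)"
          using K[OF that(1)] K[OF that(2)]
          by (intro order_trans[OF diff] mult_left_mono) auto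
        also have "\<dots> = c * q - q" by (simp add: c_def algebra_simps)
        also have "\<dots> < e\<^sup>2" using \<open>0 < q\<close> cq by simp
        finally show ?thesis using \<open>0 < e\<close> by (simp add: dist_norm power_less_imp_less_base)
      qed
      then show "\<exists>M. \<forall>m\<ge>M. \<forall>n\<ge>M. dist (?C (x (r m))) (?C (x (r n))) < e" by blast
    qed
    then show "\<exists>r a. strict_mono (r :: nat \<Rightarrow> nat) \<and> (\<lambda>k. ?C (x (r k))) \<longlonglongrightarrow> a"
      using r Cauchy_convergent convergentD by blast
  qed
qed

text \<open>The estimate of second moments is tested with the difference vector \<open>z\<close>
  itself, after which one factor \<open>norm z\<close> cancels.\<close>

lemma norm_covariance_diff_le:
  assumes X: "X \<in> L2_fun M" and Y: "Y \<in> L2_fun M"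
  defines "t \<equiv> L2_norm M (\<lambda>s. X s - Y s)"
  shows "norm (covariance M X u - covariance M Y u) \<le> norm u * (t\<^sup>2 + 2 * t * L2_norm M Y)"
proof (cases "covariance M X u = covariance M Y u")
  case True
  then show ?thesis by (simp add: t_def L2_norm_nonneg)
next
  case False
  define z where "z = covariance M X u - covariance M Y u"
  have "(norm z)\<^sup>2 = inner (covariance M X u) z - inner (covariance M Y u) z"
    unfolding power2_norm_eq_inner by (subst z_def) (simp add: inner_diff_left)
  also have "\<dots> \<le> norm u * norm z * (t\<^sup>2 + 2 * t * L2_norm M Y)"
    using second_moment_diff_le[OF X Y, of u z]
    unfolding inner_covariance[OF X] inner_covariance[OF Y] t_def by linarith
  finally have "norm z * norm z \<le> (norm u * (t\<^sup>2 + 2 * t * L2_norm M Y)) * norm z"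
    by (simp add: power2_eq_square mult_ac)
  then show ?thesis using False unfolding z_def by (simp only: mult_le_cancel_right) simp
qed

section \<open>Borel measurability for the L2 norm\<close>

lemma space_L2_borel: "space (L2_borel M) = L2_fun M"
  unfolding L2_borel_def by (rule space_measure_of) (auto simp: L2_open_def)

text \<open>The hypothesis is continuity for the seminorm, so preimages of open sets are
  \<open>L2_open\<close> and thus generators of the sigma-algebra.\<close>

lemma borel_measurable_L2_borel:
  fixes F :: "('s \<Rightarrow> 'h::{real_inner, second_countable_topology}) \<Rightarrow> 'b::metric_space"
  assumes "\<And>X e. X \<in> L2_fun M \<Longrightarrow> 0 < e \<Longrightarrow>
    \<exists>t>0. \<forall>Y\<in>L2_fun M. L2_norm M (\<lambda>s. Y s - X s) < t \<longrightarrow> dist (F Y) (F X) < e"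
  shows "F \<in> borel_measurable (L2_borel M)"
proof (rule borel_measurableI)
  fix S :: "'b set" assume "open S"
  have "L2_open M (F -` S \<inter> L2_fun M)"
    unfolding L2_open_def
  proof (intro conjI ballI)
    fix X assume X: "X \<in> F -` S \<inter> L2_fun M"
    then obtain e where "0 < e" "\<And>y. dist y (F X) < e \<Longrightarrow> y \<in> S"
      using \<open>open S\<close> unfolding open_dist by blast
    then show "\<exists>e>0. \<forall>Y\<in>L2_fun M. L2_norm M (\<lambda>s. Y s - X s) < e \<longrightarrow> Y \<in> F -` S \<inter> L2_fun M"
      using assms[of X e] X by auto
  qed simp
  then show "F -` S \<inter> space (L2_borel M) \<in> sets (L2_borel M)"
    unfolding space_L2_borel unfolding L2_borel_def
    by (subst sets_measure_of) (auto simp: L2_open_def intro!: sigma_sets.Basic)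
qed

lemma covariance_measurable: "(\<lambda>X. covariance M X u) \<in> borel_measurable (L2_borel M)"
proof (rule borel_measurable_L2_borel)
  fix X :: "'a \<Rightarrow> 'b" and e :: real
  assume X: "X \<in> L2_fun M" and "0 < e"
  have "((\<lambda>t. norm u * (t\<^sup>2 + 2 * t * L2_norm M X)) \<longlongrightarrow> norm u * (0\<^sup>2 + 2 * 0 * L2_norm M X)) (at 0)"
    by (intro tendsto_intros)
  from LIM_D[OF this \<open>0 < e\<close>] obtain t where "0 < t"
    and t: "\<And>z. z \<noteq> 0 \<Longrightarrow> \<bar>z\<bar> < t \<Longrightarrow> \<bar>norm u * (z\<^sup>2 + 2 * z * L2_norm M X)\<bar> < e"
    by auto
  have "dist (covariance M Y u) (covariance M X u) < e"
    if Y: "Y \<in> L2_fun M" and lt: "L2_norm M (\<lambda>s. Y s - X s) < t" for Y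
  proof -
    let ?z = "L2_norm M (\<lambda>s. Y s - X s)"
    \<comment> \<open>The fact \<open>t\<close> covers only nonzero arguments; at 0 the bound itself
      is 0.\<close>
    have "norm u * (?z\<^sup>2 + 2 * ?z * L2_norm M X) < e"
    proof (cases "?z = 0")
      case False
      have "0 \<le> ?z" by (rule L2_norm_nonneg)
      then show ?thesis using t[OF False] lt by linarith
    qed (simp add: \<open>0 < e\<close>)
    then show ?thesis
      using norm_covariance_diff_le[OF Y X, of u] by (simp add: dist_norm)
  qed
  then show "\<exists>t>0. \<forall>Y\<in>L2_fun M. L2_norm M (\<lambda>s. Y s - X s) < t \<longrightarrow>
      dist (covariance M Y u) (covariance M X u) < e"
    using \<open>0 < t\<close> by blast
qed

section \<open>Best approximation of low rank\<close>

lemma top_eigen_mono: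
  assumes "top_eigen A n v" and "m \<le> n"
  shows "top_eigen A m v"
  using assms unfolding top_eigen_def by auto

text \<open>A bound on \<open>edim\<close> yields a finite basis; orthogonalising it, discarding
  zero and normalising keeps the span. The set \<open>J\<close> serves as its own index set.\<close>

lemma orthonormal_basis_edim:
  fixes V :: "'h::real_inner set"
  assumes "subspace V" and "edim V \<le> enat n"
  shows "\<exists>J. finite J \<and> card J \<le> n \<and> V \<subseteq> span J \<and>
    (\<forall>a\<in>J. \<forall>b\<in>J. inner a b = (if a = b then 1 else 0))"
proof -
  obtain B where B: "finite B" "V \<subseteq> span B" and dim: "dim V \<le> n"
    using assms(2) unfolding edim_def by (auto split: if_splits)
  obtain B' where B': "B' \<subseteq> V" "independent B'" "V \<subseteq> span B'" "card B' = dim V"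
    by (rule basis_exists)
  have "finite B'" using independent_span_bound[OF B(1) B'(2)] B'(1) B(2) by blast
  from basis_orthogonal[OF this] obtain C
    where C: "finite C" "card C \<le> card B'" "span C = span B'" "pairwise orthogonal C" by blast
  have "c \<in> span (sgn ` (C - {0}))" if "c \<in> C" for c
  proof (cases "c = 0")
    case False
    then have "norm c *\<^sub>R sgn c \<in> span (sgn ` (C - {0}))"
      using that by (intro span_scale span_base) auto
    then show ?thesis using False by (simp add: sgn_div_norm)
  qed (simp add: span_zero)
  then have "span C \<subseteq> span (sgn ` (C - {0}))" by (intro span_minimal) auto
  moreover have "card (sgn ` (C - {0})) \<le> n"
  proof -
    have "card (sgn ` (C - {0})) \<le> card (C - {0})" using C(1) by (intro card_image_le) simp
    also have "\<dots> \<le> card C" using C(1) by (intro card_mono) auto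
    finally show ?thesis using C(2) B'(4) dim by simp
  qed
  moreover have "inner (sgn a) (sgn b) = (if sgn a = sgn b then 1 else 0)"
    if "a \<in> C - {0}" "b \<in> C - {0}" for a b
  proof (cases "a = b")
    case True
    then have "norm (sgn a) = 1" using that by (simp add: norm_sgn)
    then show ?thesis using True by (simp add: power2_norm_eq_inner[symmetric])
  next
    case False
    then have "inner a b = 0" using C(4) that by (simp add: pairwise_def orthogonal_def)
    then have 0: "inner (sgn a) (sgn b) = 0" by (simp add: sgn_div_norm)
    \<comment> \<open>Orthonormality is expressed through equality of the unit vectors themselves,
      so distinct members of \<open>C - {0}\<close> must not share a direction.\<close>
    moreover have "sgn a \<noteq> sgn b"
      using 0 that by (metis DiffD2 inner_eq_zero_iff insertI1 sgn_zero_iff)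
    ultimately show ?thesis by simp
  qed
  ultimately show ?thesis
    using C(1,3) B'(3) by (intro exI[of _ "sgn ` (C - {0})"]) auto
qed

text \<open>The residual \<open>r\<close> is orthogonal to the span, so Pythagoras applies to
  \<open>x - z = r + (x - r - z)\<close>.\<close>

lemma orthonormal_residual_le_dist:
  fixes J :: "'h::real_inner set"
  assumes J: "finite J" "\<And>a b. a \<in> J \<Longrightarrow> b \<in> J \<Longrightarrow> inner a b = (if a = b then 1 else 0)"
    and z: "z \<in> span J"
  shows "(norm x)\<^sup>2 - (\<Sum>a\<in>J. (inner x a)\<^sup>2) \<le> (norm (x - z))\<^sup>2"
proof -
  define r where "r = x - (\<Sum>a\<in>J. inner x a *\<^sub>R a)"
  have "orthogonal r a" if "a \<in> J" for a
    using orthonormal_residual_orthogonal[of J "\<lambda>a. a", OF J that] by (simp add: orthogonal_def r_def)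
  moreover have "x - r - z \<in> span J"
    unfolding r_def by (simp add: span_diff[OF _ z] span_sum span_scale span_base)
  ultimately have "inner r (x - r - z) = 0"
    using orthogonal_to_span unfolding orthogonal_def by blast
  then have "(norm (r + (x - r - z)))\<^sup>2 = (norm r)\<^sup>2 + (norm (x - r - z))\<^sup>2"
    by (intro norm_add_Pythagorean) (simp add: orthogonal_def)
  then have "(norm r)\<^sup>2 \<le> (norm (x - z))\<^sup>2" by simp
  then show ?thesis
    unfolding r_def using orthonormal_residual_norm[of J "\<lambda>a. a" x, OF J] by simp
qed

lemma L2_fun_inner_power2_integrable:
  assumes "X \<in> L2_fun M"
  shows "integrable M (\<lambda>s. (inner (X s) u)\<^sup>2)"
  using L2_fun_inner_mult_integrable[OF assms assms, of u u] by (simp add: power2_eq_square)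

lemma integral_residual:
  assumes X: "X \<in> L2_fun M" and J: "finite J"
  shows "(\<integral>s. (norm (X s))\<^sup>2 - (\<Sum>j\<in>J. (inner (X s) (w j))\<^sup>2) \<partial>M)
    = (L2_norm M X)\<^sup>2 - (\<Sum>j\<in>J. \<integral>s. (inner (X s) (w j))\<^sup>2 \<partial>M)"
  using L2_funD(2)[OF X] L2_fun_inner_power2_integrable[OF X]
  by (simp add: L2_norm_power2 Bochner_Integration.integral_diff Bochner_Integration.integral_sum)

text \<open>Almost surely \<open>Z s\<close> lies in the span of an orthonormal \<open>J\<close>
  with at most \<open>n\<close> elements, so the pointwise error is at least the squared residual;
  after integration Ky Fan compares \<open>J\<close> with the eigenvectors.\<close>

lemma low_rank_error_ge:
  assumes X: "X \<in> L2_fun M" and v: "top_eigen (covariance M X) n v" and Z: "Z \<in> low_rank M n"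
  shows "(L2_norm M X)\<^sup>2 - (\<Sum>i=1..n. \<integral>s. (inner (X s) (v i))\<^sup>2 \<partial>M)
    \<le> (\<integral>s. (norm (X s - Z s))\<^sup>2 \<partial>M)"
proof -
  interpret compact_positive "covariance M X" by (rule compact_positive_covariance[OF X])
  have q: "inner (covariance M X u) u = (\<integral>s. (inner (X s) u)\<^sup>2 \<partial>M)" for u
    by (simp add: inner_covariance[OF X] power2_eq_square)
  obtain V where V: "subspace V" "edim V \<le> enat n" "AE s in M. Z s \<in> V" and ZL: "Z \<in> L2_fun M"
    using Z unfolding low_rank_def by blast
  obtain J where J: "finite J" "card J \<le> n" "V \<subseteq> span J"
    and on: "\<And>a b. a \<in> J \<Longrightarrow> b \<in> J \<Longrightarrow> inner a b = (if a = b then 1 else 0)"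
    using orthonormal_basis_edim[OF V(1,2)] by blast
  have "(\<Sum>a\<in>J. \<integral>s. (inner (X s) a)\<^sup>2 \<partial>M) \<le> (\<Sum>i=1..n. \<integral>s. (inner (X s) (v i))\<^sup>2 \<partial>M)"
    using ky_fan[OF v J(1,2), of "\<lambda>a. a"] on by (simp add: q)
  then have "(L2_norm M X)\<^sup>2 - (\<Sum>i=1..n. \<integral>s. (inner (X s) (v i))\<^sup>2 \<partial>M)
      \<le> (\<integral>s. (norm (X s))\<^sup>2 - (\<Sum>a\<in>J. (inner (X s) a)\<^sup>2) \<partial>M)"
    by (simp add: integral_residual[OF X J(1), of "\<lambda>a. a"])
  also have "\<dots> \<le> (\<integral>s. (norm (X s - Z s))\<^sup>2 \<partial>M)"
  proof (rule integral_mono_AE)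
    show "integrable M (\<lambda>s. (norm (X s))\<^sup>2 - (\<Sum>a\<in>J. (inner (X s) a)\<^sup>2))"
      using L2_funD(2)[OF X] L2_fun_inner_power2_integrable[OF X] by simp
    show "integrable M (\<lambda>s. (norm (X s - Z s))\<^sup>2)" by (rule L2_funD(2)[OF L2_fun_diff[OF X ZL]])
    show "AE s in M. (norm (X s))\<^sup>2 - (\<Sum>a\<in>J. (inner (X s) a)\<^sup>2) \<le> (norm (X s - Z s))\<^sup>2"
      using V(3)
    proof eventually_elim
      case (elim s)
      then have "Z s \<in> span J" using J(3) by blast
      then show ?case by (intro orthonormal_residual_le_dist[OF J(1) on])
    qed
  qed
  finally show ?thesis .
qed

lemma orthonormal_projection_low_rank:
  fixes X :: "'s \<Rightarrow> 'h::{real_inner, second_countable_topology}"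
  assumes X: "X \<in> L2_fun M"
    and on: "\<And>i j. i \<in> {1..n} \<Longrightarrow> j \<in> {1..n} \<Longrightarrow> inner (v i) (v j) = (if i = j then 1 else 0)"
  shows "(\<lambda>s. \<Sum>i=1..n. inner (X s) (v i) *\<^sub>R v i) \<in> low_rank M n"
proof -
  let ?Z = "\<lambda>s. \<Sum>i=1..n. inner (X s) (v i) *\<^sub>R v i"
  have "norm (?Z s) \<le> norm (X s) + norm (X s)" for s
  proof -
    have "(norm (X s - ?Z s))\<^sup>2 \<le> (norm (X s))\<^sup>2"
      using orthonormal_residual_norm[of "{1..n}" v "X s", OF _ on]
      by (simp add: sum_nonneg)
    then have "norm (X s - ?Z s) \<le> norm (X s)" by (rule power2_le_imp_le) simp
    then show ?thesis
      using norm_triangle_sub[of "?Z s" "X s"] by (simp add: norm_minus_commute)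
  qed
  then have "?Z \<in> L2_fun M"
    by (intro L2_fun_bound[OF _ X X] borel_measurable_sum borel_measurable_scaleR
        borel_measurable_inner borel_measurable_const L2_funD(1)[OF X])
  moreover have "edim (span (v ` {1..n})) \<le> enat n"
  proof -
    have "dim (span (v ` {1..n})) \<le> card (v ` {1..n})" by (intro dim_le_card) auto
    also have "\<dots> \<le> n" using card_image_le[of "{1..n}" v] by simp
    finally show ?thesis unfolding edim_def by auto
  qed
  moreover have "?Z s \<in> span (v ` {1..n})" for s
    by (intro span_sum span_scale span_base) auto
  ultimately show ?thesis
    unfolding low_rank_def using subspace_span by blast
qed

text \<open>The projection onto the eigenvectors is itself of low rank and attains the lower bound,
  so the infimum is a minimum.\<close>

lemma low_rank_error_eq:
  assumes X: "X \<in> L2_fun M" and v: "top_eigen (covariance M X) n v"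
  shows "(\<integral>s. (norm (X s - (\<Sum>i=1..n. inner (X s) (v i) *\<^sub>R v i)))\<^sup>2 \<partial>M)
    = (INF Z\<in>low_rank M n. \<integral>s. (norm (X s - Z s))\<^sup>2 \<partial>M)"
proof -
  have on: "\<And>i j. i \<in> {1..n} \<Longrightarrow> j \<in> {1..n} \<Longrightarrow> inner (v i) (v j) = (if i = j then 1 else 0)"
    using v unfolding top_eigen_def by blast
  have "(norm (X s - (\<Sum>i=1..n. inner (X s) (v i) *\<^sub>R v i)))\<^sup>2
      = (norm (X s))\<^sup>2 - (\<Sum>i=1..n. (inner (X s) (v i))\<^sup>2)" for s
    by (rule orthonormal_residual_norm[OF _ on]) auto
  then have "(\<integral>s. (norm (X s - (\<Sum>i=1..n. inner (X s) (v i) *\<^sub>R v i)))\<^sup>2 \<partial>M)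
      = (L2_norm M X)\<^sup>2 - (\<Sum>i=1..n. \<integral>s. (inner (X s) (v i))\<^sup>2 \<partial>M)"
    using integral_residual[OF X, of "{1..n}" v] by simp
  then show ?thesis
    using low_rank_error_ge[OF X v]
    by (intro cInf_eq_minimum[symmetric] rev_image_eqI[OF orthonormal_projection_low_rank[OF X on]]) auto
qed

text \<open>Ky Fan makes each family optimal for its own variable. The difference of the two sums
  therefore lies between the differences obtained by using \<open>w\<close> for both variables and
  \<open>v\<close> for both, and these are controlled termwise.\<close>

lemma top_eigen_sum_diff_le:
  assumes X: "X \<in> L2_fun M" and Y: "Y \<in> L2_fun M"
    and v: "top_eigen (covariance M X) n v" and w: "top_eigen (covariance M Y) n w"
  defines "t \<equiv> L2_norm M (\<lambda>s. X s - Y s)"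
  shows "\<bar>(\<Sum>i=1..n. \<integral>s. (inner (X s) (v i))\<^sup>2 \<partial>M) - (\<Sum>i=1..n. \<integral>s. (inner (Y s) (w i))\<^sup>2 \<partial>M)\<bar>
    \<le> n * (t\<^sup>2 + 2 * t * L2_norm M Y)"
proof -
  have vo: "\<And>i j. i \<in> {1..n} \<Longrightarrow> j \<in> {1..n} \<Longrightarrow> inner (v i) (v j) = (if i = j then 1 else 0)"
    using v unfolding top_eigen_def by blast
  have wo: "\<And>i j. i \<in> {1..n} \<Longrightarrow> j \<in> {1..n} \<Longrightarrow> inner (w i) (w j) = (if i = j then 1 else 0)"
    using w unfolding top_eigen_def by blast
  have kX: "(\<Sum>i=1..n. \<integral>s. (inner (X s) (w i))\<^sup>2 \<partial>M) \<le> (\<Sum>i=1..n. \<integral>s. (inner (X s) (v i))\<^sup>2 \<partial>M)"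
    using compact_positive.ky_fan[OF compact_positive_covariance[OF X] v, of "{1..n}" w] wo
    by (simp add: inner_covariance[OF X] power2_eq_square)
  have kY: "(\<Sum>i=1..n. \<integral>s. (inner (Y s) (v i))\<^sup>2 \<partial>M) \<le> (\<Sum>i=1..n. \<integral>s. (inner (Y s) (w i))\<^sup>2 \<partial>M)"
    using compact_positive.ky_fan[OF compact_positive_covariance[OF Y] w, of "{1..n}" v] vo
    by (simp add: inner_covariance[OF Y] power2_eq_square)
  have diff: "\<bar>(\<Sum>i=1..n. \<integral>s. (inner (X s) (u i))\<^sup>2 \<partial>M) - (\<Sum>i=1..n. \<integral>s. (inner (Y s) (u i))\<^sup>2 \<partial>M)\<bar>
      \<le> n * (t\<^sup>2 + 2 * t * L2_norm M Y)"
    if on: "\<And>i. i \<in> {1..n} \<Longrightarrow> inner (u i) (u i) = 1" for u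
  proof -
    have "\<bar>(\<integral>s. (inner (X s) (u i))\<^sup>2 \<partial>M) - (\<integral>s. (inner (Y s) (u i))\<^sup>2 \<partial>M)\<bar>
        \<le> t\<^sup>2 + 2 * t * L2_norm M Y" if "i \<in> {1..n}" for i
      using second_moment_diff_le[OF X Y, of "u i" "u i"] on[OF that]
      by (simp add: norm_eq_sqrt_inner t_def power2_eq_square)
    then have "(\<Sum>i=1..n. \<bar>(\<integral>s. (inner (X s) (u i))\<^sup>2 \<partial>M) - (\<integral>s. (inner (Y s) (u i))\<^sup>2 \<partial>M)\<bar>)
        \<le> (\<Sum>i=1..n. t\<^sup>2 + 2 * t * L2_norm M Y)"
      by (rule sum_mono)
    then show ?thesis
      using sum_abs[of "\<lambda>i. (\<integral>s. (inner (X s) (u i))\<^sup>2 \<partial>M) - (\<integral>s. (inner (Y s) (u i))\<^sup>2 \<partial>M)" "{1..n}"]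
      by (simp add: sum_subtractf)
  qed
  show ?thesis
    using diff[of v] diff[of w] kX kY vo wo by (simp add: abs_le_iff)
qed

text \<open>Eigenvectors may jump where eigenvalues meet, so the argument goes through partial sums,
  whose change \<open>top_eigen_sum_diff_le\<close> bounds for any choice of the
  eigenvectors.\<close>

lemma eigenvalue_continuous_map:
  fixes X :: "'x \<Rightarrow> 's \<Rightarrow> 'h::{real_inner, complete_space, second_countable_topology}"
  assumes X: "\<And>x. x \<in> topspace S \<Longrightarrow> X x \<in> L2_fun M"
    and v: "\<And>x. x \<in> topspace S \<Longrightarrow> top_eigen (covariance M (X x)) n (\<lambda>i. v i x)"
    and cont: "\<And>y. y \<in> topspace S \<Longrightarrow>
      ((\<lambda>x. \<integral>s. (norm (X x s - X y s))\<^sup>2 \<partial>M) \<longlongrightarrow> 0) (atin S y)"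
    and i: "i \<in> {1..n}"
  shows "continuous_map S euclideanreal (\<lambda>x. \<integral>s. (inner (X x s) (v i x))\<^sup>2 \<partial>M)"
proof -
  define l where "l j x = (\<integral>s. (inner (X x s) (v j x))\<^sup>2 \<partial>M)" for j x
  have sum_cont: "continuous_map S euclideanreal (\<lambda>x. \<Sum>j=1..m. l j x)" if m: "m \<le> n" for m
    unfolding continuous_map_atin limitin_canonical_iff
  proof
    fix y assume y: "y \<in> topspace S"
    define t where "t x = L2_norm M (\<lambda>s. X x s - X y s)" for x
    have t0: "(t \<longlongrightarrow> 0) (atin S y)"
      using tendsto_real_sqrt[OF cont[OF y]] by (simp add: t_def[abs_def] L2_norm_def)
    have "((\<lambda>x. m * ((t x)\<^sup>2 + 2 * t x * L2_norm M (X y)))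
        \<longlongrightarrow> m * (0\<^sup>2 + 2 * 0 * L2_norm M (X y))) (atin S y)"
      by (intro tendsto_intros t0)
    then have b0: "((\<lambda>x. m * ((t x)\<^sup>2 + 2 * t x * L2_norm M (X y))) \<longlongrightarrow> 0) (atin S y)"
      by simp
    have "\<forall>\<^sub>F x in atin S y. x \<in> topspace S"
      unfolding eventually_atin by auto
    then have "\<forall>\<^sub>F x in atin S y. norm ((\<Sum>j=1..m. l j x) - (\<Sum>j=1..m. l j y))
        \<le> m * ((t x)\<^sup>2 + 2 * t x * L2_norm M (X y))"
    proof eventually_elim
      case (elim x)
      show ?case
        using top_eigen_sum_diff_le[OF X[OF elim] X[OF y] top_eigen_mono[OF v[OF elim] m]
            top_eigen_mono[OF v[OF y] m]]
        by (simp add: l_def t_def)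
    qed
    from Lim_null_comparison[OF this b0]
    show "((\<lambda>x. \<Sum>j=1..m. l j x) \<longlongrightarrow> (\<Sum>j=1..m. l j y)) (atin S y)"
      by (rule LIM_zero_cancel)
  qed
  \<comment> \<open>Indices start at 1, so for \<open>i = 1\<close> the subtracted sum is empty and
    \<open>sum_cont\<close> is used with \<open>m = 0\<close>.\<close>
  have "l i = (\<lambda>x. (\<Sum>j=1..i. l j x) - (\<Sum>j=1..i-1. l j x))"
    using i by (cases i) (simp_all add: fun_eq_iff)
  moreover have "continuous_map S euclideanreal (\<lambda>x. (\<Sum>j=1..i. l j x) - (\<Sum>j=1..i-1. l j x))"
    using i by (intro continuous_map_diff sum_cont) auto
  ultimately have "continuous_map S euclideanreal (l i)" by metis
  then show ?thesis by (simp add: l_def[abs_def])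
qed

theorem theorem7:
  fixes M :: "'s measure"
    and N :: "'x measure"
    and X :: "'x \<Rightarrow> 's \<Rightarrow> 'h::{real_inner, complete_space, second_countable_topology}"
    and n :: nat
  assumes "prob_space M" and "complete_measure M" and "separable_measure M"
    and "X \<in> measurable N (L2_borel M)"
    and "1 \<le> n" and "enat n \<le> edim (UNIV :: 'h set)"
  shows "\<exists>v :: nat \<Rightarrow> 'x \<Rightarrow> 'h.
    (\<forall>i\<in>{1..n}. v i \<in> borel_measurable N) \<and>
    (\<forall>\<xi>\<in>space N.
       (\<forall>i\<in>{1..n}. \<forall>j\<in>{1..n}. inner (v i \<xi>) (v j \<xi>) = (if i = j then 1 else 0)) \<and>
       (\<integral>s. (norm (X \<xi> s - (\<Sum>i=1..n. inner (X \<xi> s) (v i \<xi>) *\<^sub>R v i \<xi>)))\<^sup>2 \<partial>M)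
         = (INF Z\<in>low_rank M n. \<integral>s. (norm (X \<xi> s - Z s))\<^sup>2 \<partial>M)) \<and>
    (\<forall>d. Metric_space (space N) d \<and>
         (\<forall>\<xi>'\<in>space N.
            ((\<lambda>\<xi>. \<integral>s. (norm (X \<xi> s - X \<xi>' s))\<^sup>2 \<partial>M) \<longlongrightarrow> 0)
              (atin (Metric_space.mtopology (space N) d) \<xi>')) \<longrightarrow>
         (\<forall>i\<in>{1..n}.
            continuous_map (Metric_space.mtopology (space N) d) euclideanreal
              (\<lambda>\<xi>. \<integral>s. \<bar>inner (X \<xi> s) (v i \<xi>)\<bar>\<^sup>2 \<partial>M)))"
proof -
  have X: "X \<xi> \<in> L2_fun M" if "\<xi> \<in> space N" for \<xi>
    using measurable_space[OF assms(4) that] by (simp add: space_L2_borel)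
  have "(\<lambda>\<xi>. covariance M (X \<xi>) u) \<in> borel_measurable N" for u
    by (rule measurable_compose[OF assms(4) covariance_measurable])
  \<comment> \<open>Both the optimality and the continuity are consequences of
    \<open>top_eigen\<close> for this single family.\<close>
  from measurable_top_eigen[OF compact_positive_covariance[OF X] this assms(6)]
  obtain v where v: "\<And>i. i \<in> {1..n} \<Longrightarrow> v i \<in> borel_measurable N"
    and top: "\<And>\<xi>. \<xi> \<in> space N \<Longrightarrow> top_eigen (covariance M (X \<xi>)) n (\<lambda>i. v i \<xi>)"
    by blast
  show ?thesis
  proof (intro exI[of _ v] conjI ballI allI impI)
    show "v i \<in> borel_measurable N" if "i \<in> {1..n}" for i using that by (rule v)
    fix \<xi> assume \<xi>: "\<xi> \<in> space N"
    show "inner (v i \<xi>) (v j \<xi>) = (if i = j then 1 else 0)" if "i \<in> {1..n}" "j \<in> {1..n}" for i j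
      using top[OF \<xi>] that unfolding top_eigen_def by blast
    show "(\<integral>s. (norm (X \<xi> s - (\<Sum>i=1..n. inner (X \<xi> s) (v i \<xi>) *\<^sub>R v i \<xi>)))\<^sup>2 \<partial>M)
        = (INF Z\<in>low_rank M n. \<integral>s. (norm (X \<xi> s - Z s))\<^sup>2 \<partial>M)"
      by (rule low_rank_error_eq[OF X[OF \<xi>] top[OF \<xi>]])
  next
    \<comment> \<open>The metric first enters here: \<open>v\<close> was fixed before
      \<open>d\<close>, so the same family serves every metric.\<close>
    fix d i
    assume d: "Metric_space (space N) d \<and> (\<forall>\<xi>'\<in>space N.
      ((\<lambda>\<xi>. \<integral>s. (norm (X \<xi> s - X \<xi>' s))\<^sup>2 \<partial>M) \<longlongrightarrow> 0)
        (atin (Metric_space.mtopology (space N) d) \<xi>'))" and i: "i \<in> {1..n}"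
    have "topspace (Metric_space.mtopology (space N) d) = space N"
      using d by (simp add: Metric_space.topspace_mtopology)
    then show "continuous_map (Metric_space.mtopology (space N) d) euclideanreal
        (\<lambda>\<xi>. \<integral>s. \<bar>inner (X \<xi> s) (v i \<xi>)\<bar>\<^sup>2 \<partial>M)"
      unfolding power2_abs
      by (intro eigenvalue_continuous_map[OF _ _ _ i]) (use X top d in auto)
  qed
qed

end
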